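(* Let $s$ be a prime and $m\ge 1$ an integer such that $s^m+1=2p$ for some prime $p$ (and $10\mid s^m-1$). Let $X$ be a connected graph whose automorphism group $\mathrm{Aut}(X)$ contains a subgroup $G\cong \mathrm{PSL}(2,s^m)$ that acts transitively on the vertex set of $X$ and whose vertex stabilizer $G_v$ (for a vertex $v$) is isomorphic to $\mathbb{Z}_s^m\rtimes \mathbb{Z}_{\frac{s^m-1}{10}}$. Then $X$ contains a Hamilton cycle.
   Context: Graphs are finite, simple and undirected. $\mathbb{Z}_s^m$ denotes the elementary abelian group of order $s^m$ and $\mathbb{Z}_n$ the cyclic group of order $n$. A Hamilton cycle is a cycle passing through every vertex of the graph exactly once. *)

theory Defs
  imports
    "HOL-Analysis.Determinants"
    "HOL-Computational_Algebra.Primes"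
    "HOL-Algebra.Bij"
    "HOL-Algebra.Group_Action"
    "HOL-Algebra.Elementary_Groups"
    "HOL-Algebra.Product_Groups"
    "Graph_Theory.Graph_Theory"
begin

definition center :: "('a, 'b) monoid_scheme \<Rightarrow> 'a set" where
  "center G = {z \<in> carrier G. \<forall>g \<in> carrier G. z \<otimes>\<^bsub>G\<^esub> g = g \<otimes>\<^bsub>G\<^esub> z}"

definition SL :: "('f::field ^ 'n ^ 'n) monoid" where
  "SL = \<lparr>carrier = {A. det A = 1}, mult = (**), one = mat 1\<rparr>"

definition PSL :: "('f::field ^ 'n ^ 'n) set monoid" where
  "PSL = SL Mod center SL"

definition elementary_abelian_group :: "nat \<Rightarrow> nat \<Rightarrow> (nat \<Rightarrow> int) monoid" where
  "elementary_abelian_group s m = product_group {..<m} (\<lambda>_. integer_mod_group s)"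

text \<open>Meaningful when \<open>\<phi>\<close> is a homomorphism from \<open>H\<close> to \<open>AutoGroup N\<close>.\<close>

definition semidirect_prod ::
  "('a, 'c) monoid_scheme \<Rightarrow> ('b, 'd) monoid_scheme \<Rightarrow> ('b \<Rightarrow> 'a \<Rightarrow> 'a) \<Rightarrow> ('a \<times> 'b) monoid" where
  "semidirect_prod N H \<phi> =
    \<lparr>carrier = carrier N \<times> carrier H,
     mult = (\<lambda>(n, h) (n', h'). (n \<otimes>\<^bsub>N\<^esub> \<phi> h n', h \<otimes>\<^bsub>H\<^esub> h')),
     one = (\<one>\<^bsub>N\<^esub>, \<one>\<^bsub>H\<^esub>)\<rparr>"

text \<open>As in \<open>BijGroup\<close>, automorphisms are extensional functions on the vertex set.\<close>

definition graph_Aut :: "'v pair_pre_digraph \<Rightarrow> ('v \<Rightarrow> 'v) monoid" where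
  "graph_Aut X = BijGroup (pverts X)
    \<lparr>carrier := {f \<in> Bij (pverts X). \<forall>u \<in> pverts X. \<forall>w \<in> pverts X.
       (f u, f w) \<in> parcs X \<longleftrightarrow> (u, w) \<in> parcs X}\<rparr>"

text \<open>
  An undirected graph is a symmetric digraph, so \<open>cycle\<close> admits traversing one edge back and
  forth; the length bound excludes this. The vertices on a closed walk are the tails of its arcs,
  and \<open>cycle\<close> already demands that none is repeated.
\<close>

definition hamilton_cycle :: "'v pair_pre_digraph \<Rightarrow> ('v \<times> 'v) list \<Rightarrow> bool" where
  "hamilton_cycle X c \<longleftrightarrow>
    pre_digraph.cycle (with_proj X) c \<and> 3 \<le> length c \<and> fst ` set c = pverts X"

lemma group_SL: "group (SL :: ('f::field ^ 'n ^ 'n) monoid)"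
proof (rule groupI)
  fix A :: "'f ^ 'n ^ 'n" assume "A \<in> carrier SL"
  then have dA: "det A = 1" by (simp add: SL_def)
  then obtain B where B: "B ** A = mat 1"
    by (metis invertible_det_nz invertible_def zero_neq_one)
  then have "det B * det A = 1" by (metis det_I det_mul)
  then have "det B = 1" using dA by simp
  then show "\<exists>B \<in> carrier SL. B \<otimes>\<^bsub>SL\<^esub> A = \<one>\<^bsub>SL\<^esub>"
    using B by (auto simp: SL_def)
qed (auto simp: SL_def det_mul matrix_mul_assoc)

lemma (in group) normal_center: "center G \<lhd> G"
proof -
  have closed: "z \<in> carrier G" if "z \<in> center G" for z
    using that unfolding center_def by blast
  have comm: "z \<otimes> g = g \<otimes> z" if "z \<in> center G" "g \<in> carrier G" for z g
    using that unfolding center_def by blast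
  have "subgroup (center G) G"
  proof (rule subgroupI)
    show "center G \<subseteq> carrier G" using closed by blast
    have "\<one> \<in> center G" unfolding center_def by simp
    then show "center G \<noteq> {}" by blast
  next
    fix z assume z: "z \<in> center G"
    note zc = closed [OF z]
    have "inv z \<otimes> g = g \<otimes> inv z" if g: "g \<in> carrier G" for g
    proof -
      have "inv z \<otimes> g = inv z \<otimes> (g \<otimes> z) \<otimes> inv z"
        using zc g by (simp add: m_assoc)
      also have "\<dots> = inv z \<otimes> (z \<otimes> g) \<otimes> inv z" by (simp only: comm [OF z g])
      also have "\<dots> = g \<otimes> inv z" using zc g by (simp add: m_assoc [symmetric])
      finally show ?thesis .
    qed
    then show "inv z \<in> center G" using zc unfolding center_def by simp
  next
    fix x y assume x: "x \<in> center G" and y: "y \<in> center G"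
    have "x \<otimes> y \<otimes> g = g \<otimes> (x \<otimes> y)" if "g \<in> carrier G" for g
      using comm [OF x that] comm [OF y that] closed [OF x] closed [OF y] that
      by (metis m_assoc)
    then show "x \<otimes> y \<in> center G"
      using closed [OF x] closed [OF y] unfolding center_def by simp
  qed
  moreover have "x \<otimes> h \<otimes> inv x \<in> center G" if x: "x \<in> carrier G" and h: "h \<in> center G" for x h
  proof -
    have "x \<otimes> h \<otimes> inv x = h \<otimes> x \<otimes> inv x" by (simp only: comm [OF h x])
    also have "\<dots> = h" using x closed [OF h] by (simp add: m_assoc)
    finally show ?thesis using h by simp
  qed
  ultimately show ?thesis by (simp add: normal_inv_iff)
qed

lemma group_PSL: "group (PSL :: ('f::field ^ 'n ^ 'n) set monoid)"
  unfolding PSL_def by (intro normal.factorgroup_is_group group.normal_center group_SL)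

lemma subgroup_graph_Aut: "subgroup (carrier (graph_Aut X)) (BijGroup (pverts X))"
proof -
  interpret group "BijGroup (pverts X)" by (rule group_BijGroup)
  let ?V = "pverts X"
  have inv_edge: "(restrict (inv_into ?V f) ?V u, restrict (inv_into ?V f) ?V w) \<in> parcs X
      \<longleftrightarrow> (u, w) \<in> parcs X"
    if f: "f \<in> carrier (graph_Aut X)" and u: "u \<in> ?V" and w: "w \<in> ?V" for f u w
  proof -
    have im: "f ` ?V = ?V" using f by (auto simp: graph_Aut_def Bij_def bij_betw_def)
    have "f (inv_into ?V f u) = u" "f (inv_into ?V f w) = w"
      "inv_into ?V f u \<in> ?V" "inv_into ?V f w \<in> ?V"
      using u w im by (auto intro: f_inv_into_f inv_into_into)
    then show ?thesis using f u w by (auto simp: graph_Aut_def) metis+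
  qed
  have app: "f u \<in> ?V" if "f \<in> Bij ?V" "u \<in> ?V" for f u
    using that by (auto simp: Bij_def bij_betw_def)
  show ?thesis
  proof
    show "carrier (graph_Aut X) \<subseteq> carrier (BijGroup ?V)"
      by (auto simp: graph_Aut_def BijGroup_def)
    show "x \<otimes>\<^bsub>BijGroup ?V\<^esub> y \<in> carrier (graph_Aut X)"
      if "x \<in> carrier (graph_Aut X)" "y \<in> carrier (graph_Aut X)" for x y
      using that by (auto simp: graph_Aut_def BijGroup_def compose_Bij compose_eq app)
    show "\<one>\<^bsub>BijGroup ?V\<^esub> \<in> carrier (graph_Aut X)"
      by (auto simp: graph_Aut_def BijGroup_def id_Bij)
    show "inv\<^bsub>BijGroup ?V\<^esub> x \<in> carrier (graph_Aut X)" if x: "x \<in> carrier (graph_Aut X)" for x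
    proof -
      have xB: "x \<in> Bij ?V" using x by (simp add: graph_Aut_def)
      have "inv\<^bsub>BijGroup ?V\<^esub> x = restrict (inv_into ?V x) ?V"
        using xB by (simp add: inv_BijGroup)
      then show ?thesis
        using inv_edge [OF x] restrict_inv_into_Bij [OF xB] by (simp add: graph_Aut_def)
    qed
  qed
qed

lemma group_graph_Aut: "group (graph_Aut X)"
  using subgroup.subgroup_is_group [OF subgroup_graph_Aut group_BijGroup, of X]
  by (simp add: graph_Aut_def)

end

theory Submission
  imports
    Defs
    "HOL-Computational_Algebra.Polynomial"
    "HOL-Number_Theory.Residues"
begin

text \<open>
  Let \<open>q = s\<^sup>m\<close> and \<open>n = (q - 1) / 5\<close>. Through \<open>SL(2,q)\<close>, the vertex set becomes the set of nonzero
  vectors of the plane modulo the index-5 subgroup \<open>K = {a. a\<^sup>n = 1}\<close> of the scalars: the elementary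
  abelian part of the stabilizer is unipotent up to sign, hence fixes a unique line, and the whole
  stabilizer acts on that line through \<open>K\<close>. As \<open>X\<close> is connected, some \<open>d \<noteq> 0\<close> is such that \<open>u\<close> and
  \<open>w\<close> are adjacent whenever \<open>det(u,w) = d\<close>, so \<open>X\<close> contains a 5-fold cover of the complete graph on the
  \<open>q + 1\<close> points of the projective line. Going once around a Hamilton cycle of that complete graph,
  which has even length, multiplies the starting vector by a scalar \<open>c\<close>; if \<open>c \<notin> K\<close>, the five laps
  join up to a Hamilton cycle of \<open>X\<close>. Exchanging two consecutive points changes \<open>c\<close> by a cross ratio,
  which can be chosen outside \<open>K\<close>, so one of the two orderings works.
\<close>

section \<open>The action of SL(2) on the plane\<close>

text \<open>The determinant of the matrix with columns \<open>u\<close> and \<open>w\<close>; for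
  nonzero \<open>u\<close> it vanishes exactly when \<open>w\<close> lies on the line of
  \<open>u\<close>.\<close>

definition cross2 :: "'f::field ^ 2 \<Rightarrow> 'f ^ 2 \<Rightarrow> 'f" where
  "cross2 u w = u $ 1 * w $ 2 - u $ 2 * w $ 1"

lemma mult_vec_2:
  fixes A :: "'f::field ^ 2 ^ 2"
  shows "(A *v x) $ 1 = A $ 1 $ 1 * x $ 1 + A $ 1 $ 2 * x $ 2"
    and "(A *v x) $ 2 = A $ 2 $ 1 * x $ 1 + A $ 2 $ 2 * x $ 2"
  by (simp_all add: matrix_vector_mult_def sum_2)

lemma vec_eq_2: "(x :: 'f ^ 2) = y \<longleftrightarrow> x $ 1 = y $ 1 \<and> x $ 2 = y $ 2"
  by (simp add: vec_eq_iff forall_2)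

lemma cross2_mult: "cross2 (A *v u) (A *v w) = det A * cross2 u w"
  by (simp add: cross2_def mult_vec_2 det_2 algebra_simps)

lemma cross2_scale [simp]:
  "cross2 (a *s u) w = a * cross2 u w" "cross2 u (a *s w) = a * cross2 u w"
  by (simp_all add: cross2_def algebra_simps)

lemma cross2_add:
  "cross2 (u + u') w = cross2 u w + cross2 u' w" "cross2 u (w + w') = cross2 u w + cross2 u w'"
  by (simp_all add: cross2_def algebra_simps)

lemma cross2_self [simp]: "cross2 u u = 0"
  by (simp add: cross2_def)

lemma cross2_zero [simp]: "cross2 0 u = 0" "cross2 u 0 = 0"
  by (simp_all add: cross2_def)

lemma cross2_commute: "cross2 u w = - cross2 w u"
  by (simp add: cross2_def)

lemma cross2_eq_0D:
  assumes "cross2 u w = 0" "u \<noteq> 0"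
  obtains a where "w = a *s u"
proof (cases "u $ 1 = 0")
  case True
  then have "u $ 2 \<noteq> 0" using assms(2) by (auto simp: vec_eq_2)
  moreover have "w $ 1 = 0" using assms(1) True \<open>u $ 2 \<noteq> 0\<close> by (simp add: cross2_def)
  ultimately have "w = (w $ 2 / u $ 2) *s u" using True by (simp add: vec_eq_2)
  then show ?thesis by (rule that)
next
  case False
  then have "w = (w $ 1 / u $ 1) *s u" using assms(1) by (simp add: vec_eq_2 cross2_def field_simps)
  then show ?thesis by (rule that)
qed

lemma ex_cross2_eq_1:
  assumes "u \<noteq> 0"
  obtains t where "cross2 u t = 1"
proof (cases "u $ 1 = 0")
  case True
  then have "u $ 2 \<noteq> 0" using assms by (auto simp: vec_eq_2)
  then have "cross2 u (vector [- 1 / u $ 2, 0]) = 1" using True by (simp add: cross2_def)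
  then show ?thesis by (rule that)
next
  case False
  then have "cross2 u (vector [0, 1 / u $ 1]) = 1" by (simp add: cross2_def)
  then show ?thesis by (rule that)
qed

lemma matrix_eq_of_basis:
  fixes A B :: "'f::field ^ 2 ^ 2"
  assumes uw: "cross2 u w \<noteq> 0" and "A *v u = B *v u" "A *v w = B *v w"
  shows "A = B"
proof -
  define C where "C = A - B"
  have C: "C *v u = 0" "C *v w = 0"
    using assms by (simp_all add: C_def matrix_vector_mult_diff_rdistrib)
  have "C $ i = 0" for i
  proof -
    have e: "C $ i $ 1 * u $ 1 + C $ i $ 2 * u $ 2 = 0" "C $ i $ 1 * w $ 1 + C $ i $ 2 * w $ 2 = 0"
      using C by (simp_all add: matrix_vector_mult_def sum_2 vec_eq_iff)
    \<comment> \<open>Cramer's rule: each combination of the two equations in \<open>e\<close>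
      eliminates one entry of row \<open>i\<close>.\<close>
    have "C $ i $ 1 * cross2 u w
        = (C $ i $ 1 * u $ 1 + C $ i $ 2 * u $ 2) * w $ 2 - (C $ i $ 1 * w $ 1 + C $ i $ 2 * w $ 2) * u $ 2"
      "C $ i $ 2 * cross2 u w
        = (C $ i $ 1 * w $ 1 + C $ i $ 2 * w $ 2) * u $ 1 - (C $ i $ 1 * u $ 1 + C $ i $ 2 * u $ 2) * w $ 1"
      by (simp_all add: cross2_def algebra_simps)
    then have "C $ i $ 1 * cross2 u w = 0" "C $ i $ 2 * cross2 u w = 0"
      unfolding e by simp_all
    then show ?thesis using uw by (simp add: vec_eq_2)
  qed
  then have "C = 0" by (simp add: vec_eq_iff)
  then show ?thesis by (simp add: C_def)
qed

lemma ex_matrix_of_basis: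
  fixes u w u' w' :: "'f::field ^ 2"
  assumes uw: "cross2 u w \<noteq> 0"
  obtains A :: "'f ^ 2 ^ 2" where "A *v u = u'" "A *v w = w'"
proof -
  \<comment> \<open>The matrix with columns \<open>u'\<close>, \<open>w'\<close> times the inverse
    of the one with columns \<open>u\<close>, \<open>w\<close>.\<close>
  define A :: "'f ^ 2 ^ 2" where
    "A = (\<chi> i j. (if j = 1 then u' $ i * w $ 2 - w' $ i * u $ 2 else w' $ i * u $ 1 - u' $ i * w $ 1)
        / cross2 u w)"
  have "A *v u = u'" "A *v w = w'"
    using uw by (auto simp: vec_eq_2 mult_vec_2 A_def divide_simps)
       (simp_all add: cross2_def algebra_simps)
  then show ?thesis by (rule that)
qed

text \<open>The linear map taking one basis to the other multiplies \<open>cross2\<close> by its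
  determinant, so equal values force determinant 1. This is why adjacency can depend on
  \<open>cross2\<close> alone.\<close>

lemma SL2_transitive_on_bases:
  fixes u w u' w' :: "'f::field ^ 2"
  assumes "cross2 u w = cross2 u' w'" "cross2 u w \<noteq> 0"
  obtains A :: "'f ^ 2 ^ 2" where "det A = 1" "A *v u = u'" "A *v w = w'"
proof -
  obtain A :: "'f ^ 2 ^ 2" where A: "A *v u = u'" "A *v w = w'"
    using ex_matrix_of_basis assms(2) by blast
  then have "det A = 1" using assms cross2_mult [of A u w] by simp
  then show ?thesis using A that by blast
qed

lemma SL2_transitive:
  fixes u u' :: "'f::field ^ 2"
  assumes "u \<noteq> 0" "u' \<noteq> 0"
  obtains A :: "'f ^ 2 ^ 2" where "det A = 1" "A *v u = u'"
  by (metis SL2_transitive_on_bases ex_cross2_eq_1 assms zero_neq_one)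

text \<open>The two eigenvalues are inverse to each other, and a sign is its own inverse, so they
  coincide. Hence a nonscalar matrix with a sign as eigenvalue has only one eigenline.\<close>

lemma SL2_scalar_if_two_eigenvectors:
  fixes A :: "'f::field ^ 2 ^ 2"
  assumes "det A = 1" "A *v u = \<epsilon> *s u" "\<epsilon> * \<epsilon> = 1" "A *v w = a *s w" "cross2 u w \<noteq> 0"
  shows "A = mat \<epsilon>" "a = \<epsilon>"
proof -
  have "cross2 u w = \<epsilon> * (a * cross2 u w)"
    using cross2_mult [of A u w] assms by (simp add: mult.commute)
  then have "\<epsilon> * a = 1" using assms(5) by (metis mult.assoc mult_cancel_right2)
  then show a: "a = \<epsilon>" using assms(3) by (metis mult.left_commute mult.right_neutral)
  show "A = mat \<epsilon>"
    by (rule matrix_eq_of_basis [OF assms(5)])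
      (use assms a in \<open>simp_all add: vec_eq_2 mult_vec_2 mat_def\<close>)
qed

lemma square_eq_1: "(a :: 'f::field) * a = 1 \<longleftrightarrow> a = 1 \<or> a = - 1"
  using square_eq_1_iff by blast

lemma mat_mult_vec: "mat (a :: 'f::field) *v (x :: 'f ^ 2) = a *s x"
  by (simp add: vec_eq_2 mult_vec_2 mat_def)

lemma center_SL2: "center (SL :: ('f::field ^ 2 ^ 2) monoid) = {mat 1, mat (- 1)}"
proof
  have "mat a \<in> center (SL :: ('f ^ 2 ^ 2) monoid)" if "a * a = 1" for a :: 'f
    using that by (auto simp: center_def SL_def det_2 mat_def vec_eq_iff matrix_matrix_mult_def
        sum_2 forall_2)
  then show "{mat 1, mat (- 1)} \<subseteq> center (SL :: ('f ^ 2 ^ 2) monoid)" by simp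
next
  show "center (SL :: ('f ^ 2 ^ 2) monoid) \<subseteq> {mat 1, mat (- 1)}"
  proof
    fix Z :: "'f ^ 2 ^ 2" assume "Z \<in> center SL"
    then have dZ: "det Z = 1" and comm: "\<And>B. det B = 1 \<Longrightarrow> Z ** B = B ** Z"
      by (auto simp: center_def SL_def)
    \<comment> \<open>Commuting with two transvections already kills the off-diagonal entries and
      equates the diagonal ones.\<close>
    let ?S = "vector [vector [1, 1], vector [0, 1]] :: 'f ^ 2 ^ 2"
    let ?T = "vector [vector [1, 0], vector [1, 1]] :: 'f ^ 2 ^ 2"
    have S: "Z ** ?S = ?S ** Z" and T: "Z ** ?T = ?T ** Z" by (auto intro!: comm simp: det_2)
    have e: "Z $ 2 $ 1 = 0" "Z $ 1 $ 2 = 0" "Z $ 1 $ 1 = Z $ 2 $ 2"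
      using S T by (auto simp: vec_eq_iff forall_2 matrix_matrix_mult_def sum_2)
    then have "Z $ 2 $ 2 * Z $ 2 $ 2 = 1" using dZ by (simp add: det_2)
    then have "Z $ 2 $ 2 = 1 \<or> Z $ 2 $ 2 = - 1" by (simp add: square_eq_1)
    moreover have "Z = mat (Z $ 2 $ 2)"
      using e by (simp add: vec_eq_iff forall_2 mat_def)
    ultimately show "Z \<in> {mat 1, mat (- 1)}" by auto
  qed
qed

text \<open>Complete \<open>u\<close> to a basis by \<open>t\<close> with
  \<open>cross2 u t = 1\<close>. Determinant 1 means that \<open>t\<close> goes to
  \<open>(1 / a) *s t + b *s u\<close>, where \<open>b\<close> is a free field element.\<close>

lemma card_SL2_eigenvector:
  fixes u :: "'f::{field,finite} ^ 2"
  assumes u: "u \<noteq> 0" and a: "a \<noteq> 0"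
  shows "card {A :: 'f ^ 2 ^ 2. det A = 1 \<and> A *v u = a *s u} = CARD('f)"
proof -
  obtain t where t: "cross2 u t = 1" using ex_cross2_eq_1 [OF u] .
  have "\<exists>A :: 'f ^ 2 ^ 2. A *v u = a *s u \<and> A *v t = (1 / a) *s t + b *s u" for b
    using ex_matrix_of_basis [of u t] t by (metis zero_neq_one)
  then obtain F :: "'f \<Rightarrow> 'f ^ 2 ^ 2"
    where F: "\<And>b. F b *v u = a *s u" "\<And>b. F b *v t = (1 / a) *s t + b *s u" by metis
  have "bij_betw F UNIV {A. det A = 1 \<and> A *v u = a *s u}"
  proof (rule bij_betwI')
    fix b c :: 'f
    have "b = c" if "F b = F c"
    proof -
      have "b *s u = c *s u" using F(2) [of b] F(2) [of c] that by auto
      then show ?thesis using u by (auto simp: vec_eq_2)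
    qed
    then show "F b = F c \<longleftrightarrow> b = c" by blast
    have "det (F b) * cross2 u t = cross2 u t"
      using a by (simp add: cross2_mult [symmetric] F cross2_add)
    then show "F b \<in> {A. det A = 1 \<and> A *v u = a *s u}" using t F by simp
  next
    fix A :: "'f ^ 2 ^ 2" assume "A \<in> {A. det A = 1 \<and> A *v u = a *s u}"
    then have A: "det A = 1" "A *v u = a *s u" by auto
    have "a * cross2 u (A *v t) = 1" using cross2_mult [of A u t] A t by simp
    then have "cross2 u (A *v t) = 1 / a" using a by (simp add: field_simps)
    then have "cross2 u (A *v t + (- (1 / a)) *s t) = 0" using t by (simp only: cross2_add cross2_scale) simp
    then obtain b where "A *v t + (- (1 / a)) *s t = b *s u" using cross2_eq_0D u by blast
    then have "A *v t = (1 / a) *s t + b *s u" by (auto simp: vec_eq_2 algebra_simps)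
    then have "A = F b" using A F t by (intro matrix_eq_of_basis [of u t]) auto
    then show "\<exists>b\<in>UNIV. A = F b" by blast
  qed
  from bij_betw_same_card [OF this] show ?thesis by (rule sym)
qed

section \<open>Subgroups of SL(2) fixing a line\<close>

text \<open>The binomial theorem for the commuting operators 1 and \<open>D\<close>, meant for
  \<open>D = A - 1\<close>.\<close>

lemma funpow_one_plus:
  fixes D :: "'f::field ^ 'n \<Rightarrow> 'f ^ 'n"
  assumes add: "\<And>x y. D (x + y) = D x + D y" and scale: "\<And>c x. D (c *s x) = c *s D x"
  shows "((\<lambda>x. x + D x) ^^ n) w = (\<Sum>k\<le>n. of_nat (n choose k) *s (D ^^ k) w)"
proof (induction n)
  case 0
  then show ?case by simp
next
  case (Suc n)
  have D0: "D 0 = 0" using scale [of 0 0] by simp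
  have D_sum: "D (\<Sum>k\<in>K. f k) = (\<Sum>k\<in>K. D (f k))" for f and K :: "nat set"
    by (induction K rule: infinite_finite_induct) (auto simp: D0 add)
  let ?g = "\<lambda>n k. of_nat (n choose k) *s (D ^^ k) w"
  have "(\<Sum>k\<le>Suc n. ?g (Suc n) k) = ?g n 0 + (\<Sum>k\<le>n. ?g (Suc n) (Suc k))"
    by (simp only: sum.atMost_Suc_shift) simp
  \<comment> \<open>Pascal's rule; the terms with \<open>n choose k\<close> are \<open>D\<close>
    applied to the sum for \<open>n\<close>.\<close>
  also have "(\<Sum>k\<le>n. ?g (Suc n) (Suc k)) = (\<Sum>k\<le>n. D (?g n k)) + (\<Sum>k\<le>n. ?g n (Suc k))"
    by (simp add: scale vector_sadd_rdistrib sum.distrib)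
  also have "?g n 0 + ((\<Sum>k\<le>n. D (?g n k)) + (\<Sum>k\<le>n. ?g n (Suc k)))
      = (\<Sum>k\<le>Suc n. ?g n k) + (\<Sum>k\<le>n. D (?g n k))"
    by (simp only: sum.atMost_Suc_shift ac_simps)
  also have "(\<Sum>k\<le>Suc n. ?g n k) = (\<Sum>k\<le>n. ?g n k)" by (simp add: binomial_eq_0)
  finally show ?case using Suc by (simp add: D_sum)
qed

text \<open>In characteristic \<open>s\<close>, \<open>(A - 1)\<^sup>s = A\<^sup>s - 1 = 0\<close>.\<close>

lemma fixed_vector_if_order_dvd_char:
  fixes A :: "'f::field ^ 2 ^ 2"
  assumes s: "Factorial_Ring.prime s" "CHAR('f) = s"
    and A: "\<And>w. (((*v) A) ^^ s) w = w"
  obtains w where "w \<noteq> 0" "A *v w = w"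
proof -
  define D where "D w = A *v w - w" for w
  have add: "D (x + y) = D x + D y" for x y by (simp add: D_def matrix_vector_right_distrib)
  have scale: "D (c *s x) = c *s D x" for c x
    by (simp add: D_def vector_scalar_commute vector_ssub_ldistrib)
  have AD: "(*v) A = (\<lambda>x. x + D x)" by (auto simp: D_def)
  have "s \<noteq> 0" using s(1) by auto
  have D_s: "(D ^^ s) w = 0" for w
  proof -
    \<comment> \<open>The prime \<open>s\<close> divides every inner binomial coefficient, so only
      the terms 0 and \<open>s\<close> survive.\<close>
    have "of_nat (s choose k) = (0 :: 'f)" if "k \<in> {..s} - {0, s}" for k
      using dvd_choose_prime [of k s] that s by (auto simp: of_nat_eq_0_iff_char_dvd)
    then have "(\<Sum>k\<le>s. of_nat (s choose k) *s (D ^^ k) w)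
        = (\<Sum>k\<in>{0, s}. of_nat (s choose k) *s (D ^^ k) w)"
      by (intro sum.mono_neutral_right) auto
    then have "w = w + (D ^^ s) w"
      using A [of w] funpow_one_plus [of D s w] add scale \<open>s \<noteq> 0\<close> by (simp add: AD)
    then show ?thesis by simp
  qed
  \<comment> \<open>An injective \<open>D\<close> would have an injective \<open>s\<close>-th
    iterate, but that iterate is zero. A collision of \<open>D\<close> at \<open>x\<close> and
    \<open>y\<close> then makes \<open>x - y\<close> a fixed vector of \<open>A\<close>.\<close>
  have "\<not> inj D"
  proof
    assume "inj D"
    then have "inj (D ^^ s)" by (rule inj_fn)
    moreover have "(D ^^ s) 0 = (D ^^ s) (vector [1, 1])" by (simp only: D_s)
    ultimately have "(0 :: 'f ^ 2) = vector [1, 1]" by (rule injD)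
    then show False by (simp add: vec_eq_2)
  qed
  then obtain x y where "D x = D y" "x \<noteq> y" by (auto simp: inj_def)
  then have "A *v (x - y) = x - y" "x - y \<noteq> 0"
    by (auto simp: D_def matrix_vector_mult_diff_distrib algebra_simps)
  then show ?thesis using that by blast
qed

text \<open>As \<open>s\<close> is odd, the sign equals its own \<open>s\<close>-th power, so the
  sign times \<open>A\<close> has trivial \<open>s\<close>-th iterate and fixes a nonzero
  vector.\<close>

lemma eigenvector_if_order_dvd_char:
  fixes A :: "'f::field ^ 2 ^ 2"
  assumes s: "Factorial_Ring.prime s" "CHAR('f) = s" "odd s"
    and e: "\<epsilon> * \<epsilon> = 1" and A: "\<And>w. (((*v) A) ^^ s) w = \<epsilon> *s w"
  obtains w where "w \<noteq> 0" "A *v w = \<epsilon> *s w"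
proof -
  define B where "B = mat \<epsilon> ** A"
  have B: "B *v w = \<epsilon> *s (A *v w)" for w
    by (simp add: B_def matrix_vector_mul_assoc [symmetric] mat_mult_vec)
  have "(((*v) B) ^^ k) w = \<epsilon> ^ k *s (((*v) A) ^^ k) w" for k w
    by (induction k) (simp_all add: B vector_scalar_commute)
  moreover obtain j where "s = Suc (2 * j)" using s(3) by (auto elim: oddE)
  moreover have "\<epsilon> ^ (2 * j) = 1" using e by (simp add: power_mult power2_eq_square)
  ultimately have "(((*v) B) ^^ s) w = w" for w
    by (metis A e mult.right_neutral power_Suc vector_smult_assoc vector_smult_lid)
  then obtain w where "w \<noteq> 0" "B *v w = w" using fixed_vector_if_order_dvd_char [OF s(1,2)] by blast
  moreover have "A *v w = \<epsilon> *s (B *v w)" by (simp add: B e)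
  ultimately show ?thesis using that by simp
qed

text \<open>Multiplication by \<open>a\<close> permutes \<open>M\<close>; compare the product over
  \<open>M\<close> before and after, and cancel it.\<close>

lemma power_card_eq_1:
  fixes M :: "'f::field set"
  assumes "finite M" "0 \<notin> M" "\<And>x y. x \<in> M \<Longrightarrow> y \<in> M \<Longrightarrow> x * y \<in> M" "a \<in> M"
  shows "a ^ card M = 1"
proof -
  have a: "a \<noteq> 0" using assms by blast
  have inj: "inj_on ((*) a) M" using a by (auto simp: inj_on_def)
  have "(*) a ` M = M"
    by (rule card_subset_eq) (use assms in \<open>auto simp: card_image [OF inj]\<close>)
  then have "\<Prod>M = (\<Prod>x\<in>M. a * x)"
    using prod.reindex [OF inj, of "\<lambda>x. x"] by simp
  also have "\<dots> = a ^ card M * \<Prod>M" by (simp add: prod.distrib)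
  finally show ?thesis using assms(1,2) by auto
qed

lemma card_power_eq_1_le:
  assumes "n > 0"
  shows "card {a :: 'f::field. a ^ n = 1} \<le> n"
proof -
  let ?p = "Polynomial.monom 1 n - 1 :: 'f poly"
  have deg: "Polynomial.degree ?p = n"
    using assms degree_add_eq_left [of "- 1" "Polynomial.monom (1 :: 'f) n"] by (simp add: degree_monom_eq)
  then have "?p \<noteq> 0" using assms by auto
  then have "card {a. poly ?p a = 0} \<le> n" using card_poly_roots_bound [of ?p] deg by simp
  then show ?thesis by (simp add: poly_monom)
qed

text \<open>
  The elements of \<open>N\<close> are unipotent up to sign, and commute up to sign, so they share one eigenline;
  normality forces \<open>H\<close> to preserve it, and counting does the rest.
\<close>

lemma SL2_subgroup_is_eigenline_stabilizer:
  fixes H N :: "('f::{field,finite} ^ 2 ^ 2) set"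
  assumes s: "Factorial_Ring.prime s" "CHAR('f) = s" "odd s"
    and n: "n > 0"
    and H_SL: "\<And>A. A \<in> H \<Longrightarrow> det A = 1"
    and H_mult: "\<And>A B. A \<in> H \<Longrightarrow> B \<in> H \<Longrightarrow> A ** B \<in> H"
    and N_H: "N \<subseteq> H"
    and N_pow: "\<And>A. A \<in> N \<Longrightarrow> \<exists>\<epsilon>. \<epsilon> * \<epsilon> = 1 \<and> (\<forall>w. (((*v) A) ^^ s) w = \<epsilon> *s w)"
    and N_comm: "\<And>A B. A \<in> N \<Longrightarrow> B \<in> N \<Longrightarrow> \<exists>\<epsilon>. \<epsilon> * \<epsilon> = 1 \<and> A ** B = mat \<epsilon> ** (B ** A)"
    and N_normal: "\<And>A B. A \<in> H \<Longrightarrow> B \<in> N \<Longrightarrow> \<exists>B'\<in>N. A ** B = B' ** A"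
    and card_N: "card N = 2 * CARD('f)" and card_H: "card H = CARD('f) * n"
  obtains w where "w \<noteq> 0"
    "\<And>A. det A = 1 \<Longrightarrow> A \<in> H \<longleftrightarrow> (\<exists>a. a ^ n = 1 \<and> A *v w = a *s w)"
proof -
  have N_SL: "det A = 1" if "A \<in> N" for A using that N_H H_SL by blast
  have N_eigen: "\<exists>\<epsilon> w. \<epsilon> * \<epsilon> = 1 \<and> w \<noteq> 0 \<and> A *v w = \<epsilon> *s w" if "A \<in> N" for A
    using N_pow [OF that] eigenvector_if_order_dvd_char [OF s] by metis
  have "CARD('f) > 1"
    using card_mono [of UNIV "{0, 1 :: 'f}"] by simp
  \<comment> \<open>\<open>N\<close> is too large to consist of signs; the eigenline of a nonscalar
    \<open>B\<close> in \<open>N\<close> will be the common line.\<close>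
  have "\<not> N \<subseteq> {mat 1, mat (- 1)}"
  proof
    assume "N \<subseteq> {mat 1, mat (- 1)}"
    then have "card N \<le> card {mat 1 :: 'f ^ 2 ^ 2, mat (- 1)}" by (intro card_mono) auto
    also have "\<dots> \<le> 2" by (simp add: card_insert_if)
    finally show False using card_N \<open>CARD('f) > 1\<close> by simp
  qed
  then obtain B where B: "B \<in> N" "B \<noteq> mat 1" "B \<noteq> mat (- 1)" by blast
  obtain \<epsilon> w where e: "\<epsilon> * \<epsilon> = 1" and w: "w \<noteq> 0" and Bw: "B *v w = \<epsilon> *s w"
    using N_eigen [OF B(1)] by blast
  have B_ne: "B \<noteq> mat d" if "d * d = 1" for d using B that by (auto simp: square_eq_1)
  \<comment> \<open>\<open>B\<close> commutes with \<open>A\<close> up to a scalar, so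
    \<open>A *v w\<close> is an eigenvector of \<open>B\<close> too. Off the line of
    \<open>w\<close> it would make \<open>B\<close> scalar.\<close>
  have N_line: "cross2 w (A *v w) = 0" if A: "A \<in> N" for A
  proof (rule ccontr)
    assume nz: "cross2 w (A *v w) \<noteq> 0"
    obtain d where d: "B ** A = mat d ** (A ** B)" using N_comm [OF B(1) A] by blast
    have "B *v (A *v w) = (d * \<epsilon>) *s (A *v w)"
      by (simp add: matrix_vector_mul_assoc d) 
        (simp add: matrix_vector_mul_assoc [symmetric] Bw mat_mult_vec vector_scalar_commute)
    then have "B = mat \<epsilon>"
      using SL2_scalar_if_two_eigenvectors(1) [OF N_SL [OF B(1)] Bw e _ nz] by blast
    then show False using B_ne e by blast
  qed
  \<comment> \<open>The conjugate \<open>B'\<close> of \<open>B\<close> by \<open>A\<close> lies in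
    \<open>N\<close>, so it preserves the line of \<open>w\<close>, and it has the eigenvector
    \<open>A *v w\<close>. Were the lines different, \<open>B'\<close> and hence \<open>B\<close>
    would be scalar.\<close>
  have H_line: "cross2 w (A *v w) = 0" if A: "A \<in> H" for A
  proof (rule ccontr)
    assume nz: "cross2 w (A *v w) \<noteq> 0"
    obtain B' where B': "B' \<in> N" "A ** B = B' ** A" using N_normal [OF A B(1)] by blast
    obtain d where d: "B' *v w = d *s w" using N_line [OF B'(1)] w cross2_eq_0D by blast
    have *: "B' *v (A *v w) = \<epsilon> *s (A *v w)"
      by (simp add: matrix_vector_mul_assoc B'(2) [symmetric])
        (simp add: matrix_vector_mul_assoc [symmetric] Bw vector_scalar_commute)
    have "B' = mat \<epsilon>"
      using SL2_scalar_if_two_eigenvectors(1) [OF N_SL [OF B'(1)] * e d] nz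
        cross2_commute [of w "A *v w"] by simp
    then have AB: "A *v (B *v x) = A *v (\<epsilon> *s x)" for x
      by (simp add: matrix_vector_mul_assoc B'(2))
        (simp add: matrix_vector_mul_assoc [symmetric] mat_mult_vec vector_scalar_commute)
    have "invertible A" using H_SL [OF A] by (simp add: invertible_det_nz)
    then have "inj ((*v) A)" by (rule inj_matrix_vector_mult)
    then have "B *v x = \<epsilon> *s x" for x using AB by (auto dest: injD)
    then have "B = mat \<epsilon>" by (simp add: matrix_eq mat_mult_vec)
    then show False using B_ne e by blast
  qed
  have H_eigen: "\<exists>a. A *v w = a *s w" if "A \<in> H" for A
    using H_line [OF that] w cross2_eq_0D by blast
  let ?E = "\<lambda>a. {A :: 'f ^ 2 ^ 2. det A = 1 \<and> A *v w = a *s w}"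
  \<comment> \<open>An element of \<open>N\<close> has some eigenvector with a sign as eigenvalue.
    Whether or not that vector is on the line of \<open>w\<close>, the eigenvalue at
    \<open>w\<close> is the same sign.\<close>
  have N_sub: "N \<subseteq> ?E 1 \<union> ?E (- 1)"
  proof
    fix A assume A: "A \<in> N"
    obtain a where a: "A *v w = a *s w" using H_eigen A N_H by blast
    obtain d u where d: "d * d = 1" and u: "u \<noteq> 0" and Au: "A *v u = d *s u"
      using N_eigen [OF A] by blast
    have "a = d"
    proof (cases "cross2 u w = 0")
      case True
      then obtain c where c: "w = c *s u" using u cross2_eq_0D by blast
      then have "a *s w = d *s w"
        using a Au by (simp add: vector_scalar_commute) (auto simp: mult.commute)
      then show ?thesis using w by (auto simp: vec_eq_2)
    next
      case False
      then show ?thesis using SL2_scalar_if_two_eigenvectors(2) [OF N_SL [OF A] Au d a] by blast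
    qed
    moreover have "d = 1 \<or> d = - 1" using d by (simp only: square_eq_1)
    ultimately have "A *v w = 1 *s w \<or> A *v w = (- 1) *s w" using a by blast
    then show "A \<in> ?E 1 \<union> ?E (- 1)" using N_SL [OF A] by blast
  qed
  have card_E: "card (?E a) = CARD('f)" if "a \<noteq> 0" for a
    using card_SL2_eigenvector [OF w that] .
  \<comment> \<open>The right side has at most \<open>2 * CARD('f)\<close> elements, as many as
    \<open>N\<close>. So \<open>H\<close> contains all matrices of determinant 1 fixing
    \<open>w\<close>.\<close>
  have "N = ?E 1 \<union> ?E (- 1)"
  proof (rule card_seteq)
    show "card (?E 1 \<union> ?E (- 1)) \<le> card N"
      using card_Un_le [of "?E 1" "?E (- 1)"] card_E [of 1] card_E [of "- 1"] card_N by simp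
  qed (use N_sub in auto)
  then have E1: "?E 1 \<subseteq> H" using N_H by blast
  \<comment> \<open>The eigenvalues of \<open>H\<close> at \<open>w\<close>.\<close>
  define M where "M = {a. \<exists>A\<in>H. A *v w = a *s w}"
  have M0: "0 \<notin> M"
  proof
    assume "0 \<in> M"
    then obtain A where A: "A \<in> H" "A *v w = 0" by (auto simp: M_def)
    have "inj ((*v) A)"
      using H_SL [OF A(1)] by (intro inj_matrix_vector_mult) (simp add: invertible_det_nz)
    then show False using A(2) w by (metis injD matrix_vector_mult_0_right)
  qed
  have M_mult: "a * b \<in> M" if "a \<in> M" "b \<in> M" for a b
  proof -
    obtain A B where "A \<in> H" "A *v w = a *s w" "B \<in> H" "B *v w = b *s w"
      using \<open>a \<in> M\<close> \<open>b \<in> M\<close> unfolding M_def by blast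
    then have "A ** B \<in> H" "(A ** B) *v w = (a * b) *s w"
      by (auto intro: H_mult simp: matrix_vector_mul_assoc [symmetric] vector_scalar_commute mult.commute)
    then show ?thesis unfolding M_def by blast
  qed
  \<comment> \<open>Dividing \<open>A\<close> by an element \<open>C\<close> of \<open>H\<close>
    with the same eigenvalue leaves a matrix fixing \<open>w\<close>, which is in \<open>H\<close>.
    So \<open>H\<close> is a union of full sets \<open>?E a\<close>.\<close>
  have E_H: "?E a \<subseteq> H" if aM: "a \<in> M" for a
  proof
    fix A assume "A \<in> ?E a"
    then have A: "det A = 1" "A *v w = a *s w" by auto
    obtain C where C: "C \<in> H" "C *v w = a *s w" using aM unfolding M_def by blast
    obtain C' where C': "C ** C' = mat 1"
      using H_SL [OF C(1)] by (metis invertible_def invertible_det_nz zero_neq_one)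
    then have C'': "C' ** C = mat 1" by (simp add: matrix_left_right_inverse)
    have "det C' = 1" using arg_cong [OF C', of det] H_SL [OF C(1)] by (simp add: det_mul)
    moreover have "(C' ** A) *v w = w"
      by (simp add: matrix_vector_mul_assoc [symmetric] A C(2) [symmetric])
        (simp add: matrix_vector_mul_assoc C'')
    ultimately have "C' ** A \<in> ?E 1" using A(1) by (simp add: det_mul)
    then have "C ** (C' ** A) \<in> H" using E1 H_mult C(1) by blast
    then show "A \<in> H" by (simp add: matrix_mul_assoc C')
  qed
  have H_eq: "H = (\<Union>a\<in>M. ?E a)"
    
  proof
    show "H \<subseteq> (\<Union>a\<in>M. ?E a)" unfolding M_def using H_eigen H_SL by blast
    show "(\<Union>a\<in>M. ?E a) \<subseteq> H" using E_H by blast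
  qed
  \<comment> \<open>With \<open>CARD('f)\<close> matrices per eigenvalue, \<open>M\<close> has
    \<open>n\<close> elements. It is closed under products, so these are \<open>n\<close>-th roots
    of unity, and there are no more than \<open>n\<close> of those.\<close>
  have "card H = (\<Sum>a\<in>M. card (?E a))"
    unfolding H_eq by (rule card_UN_disjoint) (use w in auto)
  also have "\<dots> = (\<Sum>a\<in>M. CARD('f))"
  proof (rule sum.cong)
    fix a assume "a \<in> M"
    then have "a \<noteq> 0" using M0 by blast
    then show "card (?E a) = CARD('f)" by (rule card_E)
  qed simp
  finally have card_M: "card M = n" using card_H by simp
  have M_sub: "M \<subseteq> {a. a ^ n = 1}"
    
  proof
    fix a assume "a \<in> M"
    then have "a ^ card M = 1" by (intro power_card_eq_1) (simp_all add: M0 M_mult)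
    then show "a \<in> {a. a ^ n = 1}" by (simp add: card_M)
  qed
  have M_eq: "M = {a. a ^ n = 1}"
    using card_power_eq_1_le [OF n, where 'f = 'f] card_M
    by (intro card_seteq [OF _ M_sub]) simp_all
  show ?thesis
  proof (rule that [OF w])
    fix A :: "'f ^ 2 ^ 2" assume "det A = 1"
    then show "A \<in> H \<longleftrightarrow> (\<exists>a. a ^ n = 1 \<and> A *v w = a *s w)"
      unfolding H_eq M_eq by blast
  qed
qed

section \<open>Lifting Hamilton cycles of the projective line\<close>

lemma power_eq_1_of_finite_field:
  fixes a :: "'f::{field,finite}"
  assumes "a \<noteq> 0"
  shows "a ^ (CARD('f) - 1) = 1"
  using power_card_eq_1 [of "UNIV - {0}" a] assms by (simp add: card_Diff_singleton)

text \<open>As 5 is prime, the element has order exactly 5: a smaller exponent \<open>d\<close>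
  would, by Bezout, give the value 1 for the element itself.\<close>

lemma inj_on_fifth_root_powers:
  fixes \<zeta> :: "'f::field"
  assumes "\<zeta> ^ 5 = 1" "\<zeta> \<noteq> 1"
  shows "inj_on (\<lambda>k. \<zeta> ^ k) {..<5::nat}"
proof -
  have z: "\<zeta> \<noteq> 0" using assms by auto
  have "\<zeta> ^ d \<noteq> 1" if d: "0 < d" "d < 5" for d :: nat
  proof
    assume e: "\<zeta> ^ d = 1"
    have "coprime 5 d" using d by (intro prime_imp_coprime) (auto dest: dvd_imp_le)
    moreover have "d \<noteq> 1" using e assms(2) by auto
    ultimately obtain x y where "5 * x = d * y + (1 :: nat)"
      using coprime_bezout_strong [of 5 d] by auto
    then have "\<zeta> ^ (5 * x) = \<zeta> ^ (d * y) * \<zeta>" by simp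
    then show False using assms e by (simp add: power_mult)
  qed
  note no = this
  have "\<not> (k < l \<and> \<zeta> ^ k = \<zeta> ^ l)" if "l < 5" for k l :: nat
  proof
    assume kl: "k < l \<and> \<zeta> ^ k = \<zeta> ^ l"
    then have "l = k + (l - k)" by simp
    then have "\<zeta> ^ l = \<zeta> ^ k * \<zeta> ^ (l - k)" by (metis power_add)
    then show False using no [of "l - k"] kl z that by auto
  qed
  then show ?thesis by (intro inj_onI) (metis lessThan_iff linorder_neqE_nat)
qed

text \<open>
  These factors make consecutive vectors \<open>voltage d \<delta> i *s x i\<close> have \<open>cross2\<close> equal to \<open>d\<close>, when
  \<open>\<delta> i = cross2 (x i) (x (Suc i))\<close>.
\<close>

primrec voltage :: "'f::field \<Rightarrow> (nat \<Rightarrow> 'f) \<Rightarrow> nat \<Rightarrow> 'f" where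
  "voltage d \<delta> 0 = 1"
| "voltage d \<delta> (Suc i) = d / (voltage d \<delta> i * \<delta> i)"

lemma voltage_nonzero:
  assumes "d \<noteq> 0" "\<And>i. \<delta> i \<noteq> 0"
  shows "voltage d \<delta> i \<noteq> 0"
  by (induction i) (use assms in auto)

text \<open>The recursion inverts the previous value, so a discrepancy is passed on alternately as
  itself and as its inverse while the increments agree.\<close>

lemma voltage_propagate:
  assumes "\<And>i. i < N \<Longrightarrow> \<delta>' (j' + i) = \<delta> (j + i)"
    and "voltage d \<delta>' j' = voltage d \<delta> j * \<rho>" and "i \<le> N"
  shows "voltage d \<delta>' (j' + i) = voltage d \<delta> (j + i) * (if even i then \<rho> else 1 / \<rho>)"
  using assms(3) by (induction i) (use assms(1,2) in auto)

text \<open>An even period keeps this alternation in phase with the parity of the index, so every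
  lap contributes the same factor at a given point. The factor is
  \<open>voltage d \<delta> r\<close> because the value at 0 is 1.\<close>

lemma voltage_periodic:
  assumes "even r" and \<delta>: "\<And>i. \<delta> (i + r) = \<delta> i"
  shows "voltage d \<delta> (r * k + i)
    = voltage d \<delta> i * (if even i then voltage d \<delta> r ^ k else 1 / voltage d \<delta> r ^ k)"
proof (induction k)
  case 0
  then show ?case by simp
next
  case (Suc k)
  have "\<delta> (r + i) = \<delta> (0 + i)" for i using \<delta> [of i] by (simp add: add.commute)
  then have "voltage d \<delta> (r + j) = voltage d \<delta> (0 + j)
      * (if even j then voltage d \<delta> r else 1 / voltage d \<delta> r)" for j
    by (intro voltage_propagate [of j]) auto
  from this [of "r * k + i"] Suc show ?case using \<open>even r\<close>
    by (auto simp: add.assoc)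
qed

text \<open>One vector for each point: infinity first, then the affine points in the order of
  \<open>ps\<close>.\<close>

definition projective_line :: "'f::field list \<Rightarrow> ('f ^ 2) list" where
  "projective_line ps = vector [1, 0] # map (\<lambda>c. vector [c, 1]) ps"

lemma cross2_projective_line:
  assumes "distinct ps" "i < Suc (length ps)" "j < Suc (length ps)" "i \<noteq> j"
  shows "cross2 (projective_line ps ! i) (projective_line ps ! j) \<noteq> 0"
  using assms
  by (cases i; cases j) (auto simp: projective_line_def cross2_def nth_eq_iff_index_eq)

lemma projective_line_covers:
  assumes "set ps = UNIV" "w \<noteq> 0"
  obtains i a where "i < Suc (length ps)" "a \<noteq> 0" "w = a *s (projective_line ps ! i)"
proof (cases "w $ 2 = 0")
  case True
  then show ?thesis
    using assms(2) by (intro that [of 0 "w $ 1"]) (auto simp: projective_line_def vec_eq_2)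
next
  case False
  obtain i where "i < length ps" "ps ! i = w $ 1 / w $ 2"
    using assms(1) by (metis UNIV_I in_set_conv_nth)
  then show ?thesis using False
    by (intro that [of "Suc i" "w $ 2"]) (auto simp: projective_line_def vec_eq_2)
qed

definition cyclic_nth :: "'a list \<Rightarrow> nat \<Rightarrow> 'a" where
  "cyclic_nth xs i = xs ! (i mod length xs)"

text \<open>There is one point more than entries of \<open>ps\<close>, so the value at
  \<open>Suc (length ps)\<close> is the holonomy of one lap.\<close>

definition line_voltage :: "'f::field \<Rightarrow> 'f list \<Rightarrow> nat \<Rightarrow> 'f" where
  "line_voltage d ps = voltage d (\<lambda>i. cross2 (cyclic_nth (projective_line ps) i)
     (cyclic_nth (projective_line ps) (Suc i)))"

text \<open>
  Exchanging the second and third of the points \<open>\<infinity>, 1, -z, 0\<close> multiplies the holonomy by their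
  cross ratio, up to inversion.
\<close>

lemma ex_nontrivial_holonomy:
  fixes d :: "'f::{field,finite}"
  assumes q: "CARD('f) = 5 * n + 1" "odd CARD('f)" "n > 0" and d: "d \<noteq> 0"
  obtains ps where "distinct ps" "set ps = (UNIV :: 'f set)"
    "line_voltage d ps (Suc CARD('f)) ^ n \<noteq> 1"
proof -
  \<comment> \<open>Room for a cross ratio \<open>z\<close> outside the \<open>n\<close>-th roots of
    unity; avoiding 0 and -1 keeps 1, \<open>- z\<close> and 0 distinct.\<close>
  have "card ({a :: 'f. a ^ n = 1} \<union> {0, - 1}) < CARD('f)"
  proof -
    have "card ({a :: 'f. a ^ n = 1} \<union> {0, - 1}) \<le> card {a :: 'f. a ^ n = 1} + card {0 :: 'f, - 1}"
      by (rule card_Un_le)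
    also have "\<dots> \<le> n + 2"
      using card_power_eq_1_le [OF \<open>n > 0\<close>, where 'f = 'f] by (simp add: card_insert_if)
    finally show ?thesis using q by simp
  qed
  then have "{a :: 'f. a ^ n = 1} \<union> {0, - 1} \<noteq> UNIV" by auto
  then obtain z :: 'f where z: "z ^ n \<noteq> 1" "z \<noteq> 0" "z \<noteq> - 1" by blast
  have z': "- z \<noteq> 1" using z(3) by (metis minus_minus)
  obtain zs where zs: "distinct zs" "set zs = UNIV - {1, - z, 0 :: 'f}"
    using finite_distinct_list [of "UNIV - {1, - z, 0 :: 'f}"] by auto
  define ps where "ps = 1 # - z # 0 # zs"
  define ps' where "ps' = - z # 1 # 0 # zs"
  have ps: "distinct ps" "set ps = UNIV" "distinct ps'" "set ps' = UNIV"
    using zs z z' by (auto simp: ps_def ps'_def)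
  have len: "length ps = CARD('f)" "length ps' = CARD('f)"
    using ps distinct_card by metis+
  then have lens: "length (projective_line ps) = Suc CARD('f)"
    "length (projective_line ps') = Suc CARD('f)"
    by (simp_all add: projective_line_def)
  have q3: "CARD('f) \<ge> 3" using len(1) by (simp add: ps_def)
  let ?x = "cyclic_nth (projective_line ps)" and ?x' = "cyclic_nth (projective_line ps')"
  let ?\<delta> = "\<lambda>i. cross2 (?x i) (?x (Suc i))" and ?\<delta>' = "\<lambda>i. cross2 (?x' i) (?x' (Suc i))"
  have small: "i mod Suc CARD('f) = i" if "i \<le> 3" for i using that q3 by simp
  have x: "?x 0 = vector [1, 0]" "?x 1 = vector [1, 1]" "?x 2 = vector [- z, 1]" "?x 3 = vector [0, 1]"
    "?x' 0 = vector [1, 0]" "?x' 1 = vector [- z, 1]" "?x' 2 = vector [1, 1]" "?x' 3 = vector [0, 1]"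
    unfolding cyclic_nth_def lens using small [of 0] small [of 1] small [of 2] small [of 3]
    by (simp_all add: projective_line_def ps_def ps'_def numeral_eq_Suc)
  \<comment> \<open>The two cycles agree from index 3 up to and including the return to
    infinity.\<close>
  have x_eq: "?x i = ?x' i" if "3 \<le> i" "i \<le> Suc CARD('f)" for i
  proof (cases "i = Suc CARD('f)")
    case True
    then show ?thesis by (simp add: cyclic_nth_def lens) (simp add: projective_line_def)
  next
    case False
    obtain j where "i = Suc (Suc (Suc j))" using \<open>3 \<le> i\<close> by (metis Suc_le_D Suc_le_mono numeral_3_eq_3)
    moreover have "i mod Suc CARD('f) = i" using False that by simp
    ultimately show ?thesis
      unfolding cyclic_nth_def lens by (simp add: projective_line_def ps_def ps'_def)
  qed
  have z1: "1 + z \<noteq> 0" using z(3) by (metis add.commute add_eq_0_iff)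
  \<comment> \<open>The value at 3 is \<open>d\<close> times the middle increment divided by the two
    outer ones; the quotient of both values is \<open>z\<close>.\<close>
  have "voltage d ?\<delta>' 3 = voltage d ?\<delta> 3 * z"
    using x d z z1 by (simp add: numeral_eq_Suc cross2_def) (simp add: field_simps)
  then have "voltage d ?\<delta>' (3 + (CARD('f) - 2)) = voltage d ?\<delta> (3 + (CARD('f) - 2))
      * (if even (CARD('f) - 2) then z else 1 / z)"
    by (rule voltage_propagate [rotated]) (use x_eq q3 in auto)
  \<comment> \<open>The remaining number of steps is odd, so the factor arrives as
    \<open>1 / z\<close>. The holonomies cannot both be \<open>n\<close>-th roots of unity, since
    \<open>z\<close> is not one.\<close>
  moreover have "3 + (CARD('f) - 2) = Suc CARD('f)" "odd (CARD('f) - 2)" using q3 q(2) by auto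
  ultimately have "line_voltage d ps' (Suc CARD('f)) = line_voltage d ps (Suc CARD('f)) / z"
    by (simp add: line_voltage_def del: voltage.simps)
  then have "line_voltage d ps' (Suc CARD('f)) ^ n \<noteq> 1 \<or> line_voltage d ps (Suc CARD('f)) ^ n \<noteq> 1"
    using z by (auto simp: power_divide)
  then show ?thesis using that ps by blast
qed

text \<open>Five laps around the projective line. The power \<open>c ^ n\<close> of the holonomy
  \<open>c\<close> is a fifth root of unity other than 1, so the laps pass through the five cosets
  of the \<open>n\<close>-th roots of unity, each once.\<close>

lemma ex_hamiltonian_lift:
  fixes d :: "'f::{field,finite}"
  assumes q: "CARD('f) = 5 * n + 1" "odd CARD('f)" "n > 0" and d: "d \<noteq> 0"
  obtains y :: "nat \<Rightarrow> 'f ^ 2" and L where "L \<ge> 3" "\<And>i. y i \<noteq> 0" "\<And>i. cross2 (y i) (y (Suc i)) = d"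
    "\<exists>a. a ^ n = 1 \<and> y L = a *s y 0"
    "\<And>i j a. i < L \<Longrightarrow> j < L \<Longrightarrow> a ^ n = 1 \<Longrightarrow> y j = a *s y i \<Longrightarrow> i = j"
    "\<And>w. w \<noteq> 0 \<Longrightarrow> \<exists>i<L. \<exists>a. a ^ n = 1 \<and> w = a *s y i"
proof -
  obtain ps where ps: "distinct ps" "set ps = (UNIV :: 'f set)"
    and hol: "line_voltage d ps (Suc CARD('f)) ^ n \<noteq> 1"
    using ex_nontrivial_holonomy [OF q d] .
  define r where "r = Suc CARD('f)"
  define x where "x = cyclic_nth (projective_line ps)"
  define \<delta> where "\<delta> i = cross2 (x i) (x (Suc i))" for i
  define b where "b = voltage d \<delta>"
  define c where "c = b r"
  define y where "y i = b i *s x i" for i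
  have len: "length ps = CARD('f)" using ps distinct_card by metis
  have lens: "length (projective_line ps) = r" by (simp add: projective_line_def len r_def)
  have r: "even r" "r \<ge> 3" using q by (auto simp: r_def)
  have x_mod: "x i = projective_line ps ! (i mod r)" for i by (simp add: x_def cyclic_nth_def lens)
  have x_per: "x (r * k + i) = x i" for k i by (simp add: x_mod)
  have mod_r: "i mod r < Suc (length ps)" for i using r by (simp add: len r_def)
  have cross_x: "cross2 (x i) (x j) \<noteq> 0" if "i mod r \<noteq> j mod r" for i j
    unfolding x_mod using cross2_projective_line [OF ps(1) mod_r mod_r that] .
  have "Suc i mod r \<noteq> i mod r" for i using r by (simp add: mod_Suc)
  then have \<delta>_nz: "\<delta> i \<noteq> 0" for i unfolding \<delta>_def by (metis cross_x)
  then have x_nz: "x i \<noteq> 0" for i unfolding \<delta>_def by (metis cross2_zero(1))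
  have b_nz: "b i \<noteq> 0" for i unfolding b_def using d \<delta>_nz by (rule voltage_nonzero)
  have b_Suc: "b (Suc i) = d / (b i * \<delta> i)" for i by (simp add: b_def)
  have "\<delta> (i + r) = \<delta> i" for i
    using x_per [of 1 i] x_per [of 1 "Suc i"] by (simp add: \<delta>_def add.commute)
  then have b_per: "b (r * k + i) = b i * (if even i then c ^ k else 1 / c ^ k)" for k i
    unfolding c_def b_def using voltage_periodic r(1) by blast
  have c_nz: "c \<noteq> 0" by (simp add: c_def b_nz)
  have c_n: "c ^ n \<noteq> 1"
    using hol by (simp add: c_def b_def line_voltage_def r_def \<delta>_def [abs_def] x_def)
  \<comment> \<open>Since the multiplicative group has order \<open>5 * n\<close>, the
    \<open>n\<close>-th power map takes values in the fifth roots of unity and tells the five cosets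
    apart.\<close>
  have fifth: "(a ^ n) ^ 5 = 1" if "a \<noteq> 0" for a :: 'f
    using power_eq_1_of_finite_field [OF that] q(1) by (simp add: power_mult [symmetric] mult.commute)
  have inj: "inj_on (\<lambda>k. (c ^ n) ^ k) {..<5::nat}"
    using inj_on_fifth_root_powers fifth [OF c_nz] c_n by blast
  have roots: "(\<lambda>k. (c ^ n) ^ k) ` {..<5::nat} = {a. a ^ 5 = 1}"
  proof (rule card_seteq)
    show "(\<lambda>k. (c ^ n) ^ k) ` {..<5::nat} \<subseteq> {a. a ^ 5 = 1}"
      using fifth [OF c_nz] by (auto simp: power_mult [symmetric] mult.commute)
        (metis power_mult power_one mult.commute)
    show "card {a :: 'f. a ^ 5 = 1} \<le> card ((\<lambda>k. (c ^ n) ^ k) ` {..<5::nat})"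
      using card_power_eq_1_le [of 5, where 'f = 'f] by (simp add: card_image inj)
  qed simp
  have coset: "\<exists>k<5. (e / c ^ k) ^ n = 1" if "e \<noteq> 0" for e :: 'f
  proof -
    have "e ^ n \<in> (\<lambda>k. (c ^ n) ^ k) ` {..<5::nat}" using roots fifth [OF that] by blast
    then obtain k where "k < 5" "e ^ n = (c ^ n) ^ k" by auto
    then have "(e / c ^ k) ^ n = 1"
      using c_nz by (simp add: power_divide power_mult [symmetric] mult.commute)
    then show ?thesis using \<open>k < 5\<close> by blast
  qed
  show ?thesis
  proof (rule that [of "5 * r" y])
    show "3 \<le> 5 * r" using r by simp
    show "y i \<noteq> 0" for i using b_nz x_nz by (simp add: y_def)
    show "cross2 (y i) (y (Suc i)) = d" for i
      using b_nz [of i] \<delta>_nz [of i] by (simp add: y_def b_Suc) (simp add: \<delta>_def)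
    have "y (5 * r) = c ^ 5 *s y 0"
      using b_per [of 5 0] x_per [of 5 0] by (simp add: y_def mult.commute)
    moreover have "(c ^ 5) ^ n = 1" using fifth [OF c_nz] by (metis mult.commute power_mult)
    ultimately show "\<exists>a. a ^ n = 1 \<and> y (5 * r) = a *s y 0" by blast
  next
    fix i j a assume ij: "i < 5 * r" "j < 5 * r" and a: "a ^ n = 1" and e: "y j = a *s y i"
    \<comment> \<open>Proportional vectors represent the same point, so \<open>i\<close> and
      \<open>j\<close> can differ only in the lap.\<close>
    have "b i * (b j * cross2 (x i) (x j)) = 0"
      using arg_cong [OF e, of "cross2 (y i)"] by (auto simp: y_def)
    then have m: "i mod r = j mod r" using cross_x b_nz by (metis mult_eq_0_iff)
    define t where "t = i mod r"
    define k l where "k = i div r" and "l = j div r"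
    have i: "i = r * k + t" and j: "j = r * l + t" 
      by (simp add: t_def k_def) (simp add: t_def l_def m)
    have kl: "k < 5" "l < 5" using ij r by (simp_all add: k_def l_def div_less_iff_less_mult)
    have "b j *s x t = (a * b i) *s x t" using e by (simp add: y_def i j x_per)
    then have ab: "b j = a * b i" using x_nz [of t] by (simp add: vec_eq_2) auto
    have "(c ^ n) ^ k = (c ^ n) ^ l"
    proof (cases "even t")
      case True
      then have "c ^ l = a * c ^ k" using ab b_nz [of t] b_per by (simp add: i j)
      then have "(c ^ l) ^ n = (c ^ k) ^ n" using a by (simp add: power_mult_distrib)
      then show ?thesis by (metis mult.commute power_mult)
    next
      case False
      then have "c ^ k = a * c ^ l" using ab b_nz [of t] c_nz b_per by (simp add: i j field_simps)
      then have "(c ^ l) ^ n = (c ^ k) ^ n" using a by (simp add: power_mult_distrib)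
      then show ?thesis by (metis mult.commute power_mult)
    qed
    then have "k = l" using inj kl by (auto dest: inj_onD)
    then show "i = j" by (simp add: i j)
  next
    fix w :: "'f ^ 2" assume "w \<noteq> 0"
    then obtain t a where t: "t < r" and a: "a \<noteq> 0" and w: "w = a *s x t"
      using projective_line_covers [OF ps(2)] len by (metis mod_less r_def x_mod)
    have "\<exists>k<5. (a / b (r * k + t)) ^ n = 1"
    proof (cases "even t")
      case True
      then show ?thesis using coset [of "a / b t"] a b_nz [of t] by (simp add: b_per)
    next
      case False
      \<comment> \<open>At odd positions a lap divides by \<open>c\<close>, so the coset of the
        inverse scalar determines the lap.\<close>
      obtain k where "k < 5" "((b t / a) / c ^ k) ^ n = 1"
        using coset [of "b t / a"] a b_nz [of t] by auto
      then have "(a / b (r * k + t)) ^ n = 1"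
        unfolding b_per using False a b_nz [of t] c_nz
        by (simp add: power_divide power_mult_distrib field_simps)
      then show ?thesis using \<open>k < 5\<close> by blast
    qed
    then obtain k where k: "k < 5" "(a / b (r * k + t)) ^ n = 1" by blast
    have "r * k + t < r * Suc k" using t by simp
    also have "\<dots> \<le> r * 5" using k by (intro mult_le_mono) auto
    finally have "r * k + t < 5 * r" by (simp add: mult.commute)
    moreover have "w = (a / b (r * k + t)) *s y (r * k + t)" by (simp add: w y_def x_per b_nz)
    ultimately show "\<exists>i<5 * r. \<exists>a. a ^ n = 1 \<and> w = a *s y i" using k(2) by blast
  qed
qed

section \<open>Graphs with an action of SL(2)\<close>

text \<open>The start \<open>k\<close> is arbitrary so that the induction can peel off the first
  arc.\<close>

lemma walk_map_upt:
  "pcas (f k) (map (\<lambda>i. (f i, f (Suc i))) [k..<k + n]) (f (k + n)) \<and>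
   pawalk_verts (f k) (map (\<lambda>i. (f i, f (Suc i))) [k..<k + n]) = map f [k..<Suc (k + n)]"
proof (induction n arbitrary: k)
  case 0
  show ?case by simp
next
  case (Suc n)
  have "[k..<k + Suc n] = k # [Suc k..<Suc k + n]" "[k..<Suc (k + Suc n)] = k # [Suc k..<Suc (Suc k + n)]"
    by (simp_all add: upt_conv_Cons del: upt_Suc)
  then show ?case using Suc [of "Suc k"] by (simp del: upt_Suc)
qed

lemma hamilton_cycle_map_upt:
  assumes "L \<ge> 3" and img: "f ` {..<L} = pverts X" and inj: "inj_on f {..<L}"
    and arcs: "\<And>i. i < L \<Longrightarrow> (f i, f (Suc i)) \<in> parcs X" and closed: "f L = f 0"
  shows "hamilton_cycle X (map (\<lambda>i. (f i, f (Suc i))) [0..<L])" (is "hamilton_cycle X ?c")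
proof -
  have cas: "pcas (f 0) ?c (f 0)" using walk_map_upt [of f 0 L] closed by simp
  have verts: "pawalk_verts (f 0) ?c = map f [0..<Suc L]"
    using walk_map_upt [of f 0 L] by simp
  \<comment> \<open>Distinctness is demanded of the vertex list without its head; the final
    \<open>f L\<close> stands in for \<open>f 0\<close>.\<close>
  have "tl (map f [0..<Suc L]) = map f [1..<L] @ [f L]"
    using assms(1) by (simp add: map_tl [symmetric] tl_upt del: upt_Suc) simp
  moreover have "distinct (map f [1..<L] @ [f 0])"
    using inj assms(1) by (fastforce simp: distinct_map inj_on_def)
  ultimately have "distinct (tl (pawalk_verts (f 0) ?c))"
    unfolding verts by (simp add: closed)
  moreover have "f 0 \<in> pverts X" using img assms(1) by auto
  moreover have "set ?c \<subseteq> parcs X" using arcs by auto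
  ultimately have "pre_digraph.cycle (with_proj X) ?c"
    unfolding pre_digraph.cycle_def pre_digraph.awalk_def cas_with_proj_eq awalk_verts_with_proj_eq
    using cas assms(1) by (intro exI [of _ "f 0"]) auto
  moreover have "fst ` set ?c = pverts X"
    using img by (auto simp: image_image atLeast0LessThan)
  ultimately show ?thesis using assms(1) by (simp add: hamilton_cycle_def)
qed

text \<open>Arcs are symmetric, so connectedness yields directed paths from \<open>v\<close> to
  every vertex, and these cannot leave \<open>S\<close>.\<close>

lemma connected_pair_graph_closed_set:
  assumes "pair_graph X" "Digraph_Component.connected (with_proj X)"
    and S: "v \<in> S" "v \<in> pverts X" "\<And>x y. x \<in> S \<Longrightarrow> (x, y) \<in> parcs X \<Longrightarrow> y \<in> S"
  shows "pverts X \<subseteq> S"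
proof
  fix u assume u: "u \<in> pverts X"
  interpret pair_graph X by fact
  have "strongly_connected (with_proj X)"
    using symmetric_connected_imp_strongly_connected pair_sym_arcs assms(2) by blast
  then have "v \<rightarrow>\<^sup>*\<^bsub>with_proj X\<^esub> u" using u S(2) by (auto simp: strongly_connected_def)
  then show "u \<in> S"
    by (induction rule: reachable_induct) (use S in auto)
qed

lemma SL2_inverse:
  fixes A :: "'f::field ^ 2 ^ 2"
  assumes "det A = 1"
  obtains B where "det B = 1" "A ** B = mat 1" "B ** A = mat 1"
proof -
  obtain B where B: "A ** B = mat 1" "B ** A = mat 1"
    using assms by (metis invertible_def invertible_det_nz zero_neq_one)
  then have "det A * det B = 1" by (metis det_I det_mul)
  then show ?thesis using that B assms by simp
qed

text \<open>
  The vertices are the orbits of nonzero vectors under the scalars \<open>a\<close> with \<open>a ^ n = 1\<close>, and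
  adjacency of vertices on different lines depends only on the value of \<open>cross2\<close>.
\<close>

lemma hamiltonian_if_SL2_acts:
  fixes X :: "'v pair_pre_digraph" and act :: "'f::{field,finite} ^ 2 ^ 2 \<Rightarrow> 'v \<Rightarrow> 'v"
  assumes X: "pair_graph X" "Digraph_Component.connected (with_proj X)" and v: "v \<in> pverts X"
    and q: "CARD('f) = 5 * n + 1" "odd CARD('f)" "n > 0"
    and closed: "\<And>A x. det A = 1 \<Longrightarrow> x \<in> pverts X \<Longrightarrow> act A x \<in> pverts X"
    and mult: "\<And>A B x. det A = 1 \<Longrightarrow> det B = 1 \<Longrightarrow> x \<in> pverts X \<Longrightarrow>
      act (A ** B) x = act A (act B x)"
    and arcs: "\<And>A x y. det A = 1 \<Longrightarrow> x \<in> pverts X \<Longrightarrow> y \<in> pverts X \<Longrightarrow>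
      (act A x, act A y) \<in> parcs X \<longleftrightarrow> (x, y) \<in> parcs X"
    and trans: "\<And>x. x \<in> pverts X \<Longrightarrow> \<exists>A. det A = 1 \<and> act A v = x"
    and w0: "w0 \<noteq> 0"
    and stab: "\<And>A. det A = 1 \<Longrightarrow> act A v = v \<longleftrightarrow> (\<exists>a. a ^ n = 1 \<and> A *v w0 = a *s w0)"
  shows "\<exists>c. hamilton_cycle X c"
proof -
  interpret pair_graph X by fact
  \<comment> \<open>No identity law is assumed for \<open>act\<close>; at \<open>v\<close> it
    follows from \<open>stab\<close> with eigenvalue 1.\<close>
  have one_v: "act (mat 1) v = v" using stab [of "mat 1"] by (auto intro!: exI [of _ 1])
  \<comment> \<open>The vertex of a nonzero vector \<open>w\<close>: move \<open>v\<close> by any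
    matrix of determinant 1 taking \<open>w0\<close> to \<open>w\<close>. By \<open>act_eq\<close>
    the choice does not matter.\<close>
  define \<nu> where "\<nu> w = act (SOME A. det A = 1 \<and> A *v w0 = w) v" for w
  have act_eq: "act A v = act B v \<longleftrightarrow> (\<exists>a. a ^ n = 1 \<and> B *v w0 = a *s (A *v w0))"
    if A: "det A = 1" and B: "det B = 1" for A B
  proof -
    obtain C where C: "det C = 1" "A ** C = mat 1" "C ** A = mat 1" using SL2_inverse [OF A] .
    have "act A v = act B v \<longleftrightarrow> act (C ** B) v = v"
    proof
      assume "act A v = act B v"
      then have "act (C ** B) v = act (C ** A) v"
        using mult [OF C(1) A v] mult [OF C(1) B v] by simp
      then show "act (C ** B) v = v" by (simp add: C one_v)
    next
      assume "act (C ** B) v = v"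
      then have "act A v = act (A ** (C ** B)) v"
        using mult [of A "C ** B" v] A B C(1) v by (simp add: det_mul)
      then show "act A v = act B v" by (simp add: matrix_mul_assoc C)
    qed
    also have "\<dots> \<longleftrightarrow> (\<exists>a. a ^ n = 1 \<and> C *v (B *v w0) = a *s w0)"
      using stab [of "C ** B"] B C(1) by (simp add: det_mul matrix_vector_mul_assoc)
    also have "\<dots> \<longleftrightarrow> (\<exists>a. a ^ n = 1 \<and> B *v w0 = a *s (A *v w0))"
    proof -
      have AC: "A *v (C *v x) = x" and CA: "C *v (A *v x) = x" for x
        by (simp_all add: matrix_vector_mul_assoc C)
      have "C *v (B *v w0) = a *s w0 \<longleftrightarrow> B *v w0 = a *s (A *v w0)" for a
      proof
        assume "C *v (B *v w0) = a *s w0"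
        then have "A *v (C *v (B *v w0)) = a *s (A *v w0)" by (simp add: vector_scalar_commute)
        then show "B *v w0 = a *s (A *v w0)" by (simp only: AC)
      next
        assume "B *v w0 = a *s (A *v w0)"
        then show "C *v (B *v w0) = a *s w0" by (simp add: vector_scalar_commute CA)
      qed
      then show ?thesis by simp
    qed
    finally show ?thesis .
  qed
  have \<nu>: "\<nu> (A *v w0) = act A v" if A: "det A = 1" for A
  proof -
    let ?B = "SOME B. det B = 1 \<and> B *v w0 = A *v w0"
    have "det ?B = 1 \<and> ?B *v w0 = A *v w0" by (rule someI [of _ A]) (simp add: A)
    then have "act ?B v = act A v" using act_eq [of ?B A] A by (auto intro!: exI [of _ 1])
    then show ?thesis by (simp add: \<nu>_def)
  qed
  have ex: "\<exists>A. det A = 1 \<and> A *v w0 = w" if "w \<noteq> 0" for w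
    using SL2_transitive [OF w0 that] by blast
  have \<nu>_in: "\<nu> w \<in> pverts X" if "w \<noteq> 0" for w
    using ex [OF that] \<nu> closed v by force
  have \<nu>_eq: "\<nu> u = \<nu> w \<longleftrightarrow> (\<exists>a. a ^ n = 1 \<and> w = a *s u)" if u: "u \<noteq> 0" and w: "w \<noteq> 0" for u w
  proof -
    obtain A B where "det A = 1" "A *v w0 = u" "det B = 1" "B *v w0 = w" using ex u w by metis
    then show ?thesis using act_eq [of A B] \<nu> [of A] \<nu> [of B] by simp
  qed
  have \<nu>_surj: "\<exists>w. w \<noteq> 0 \<and> \<nu> w = x" if x: "x \<in> pverts X" for x
  proof -
    obtain A where A: "det A = 1" "act A v = x" using trans [OF x] by blast
    obtain C where "C ** A = mat 1" using SL2_inverse [OF A(1)] .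
    then have "C *v (A *v w0) = w0" by (simp add: matrix_vector_mul_assoc)
    then have "A *v w0 \<noteq> 0" using w0 by auto
    then show ?thesis using \<nu> A by blast
  qed
  have \<nu>_act: "act A (\<nu> w) = \<nu> (A *v w)" if A: "det A = 1" and w: "w \<noteq> 0" for A w
  proof -
    obtain B where B: "det B = 1" "B *v w0 = w" using ex [OF w] by blast
    then show ?thesis
      using mult [of A B v] \<nu> [of "A ** B"] \<nu> [of B] A v by (auto simp: det_mul matrix_vector_mul_assoc)
  qed
  have \<nu>_arcs: "(\<nu> u, \<nu> w) \<in> parcs X \<longleftrightarrow> (\<nu> u', \<nu> w') \<in> parcs X"
    if e: "cross2 u w = cross2 u' w'" and nz: "cross2 u w \<noteq> 0" for u w u' w'
  proof -
    have "u \<noteq> 0" "w \<noteq> 0" using nz by auto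
    moreover obtain A :: "'f ^ 2 ^ 2" where "det A = 1" "A *v u = u'" "A *v w = w'"
      using SL2_transitive_on_bases [OF e nz] .
    ultimately show ?thesis using arcs [of A "\<nu> u" "\<nu> w"] \<nu>_act \<nu>_in by auto
  qed
  \<comment> \<open>Otherwise the vertices on the line of \<open>w0\<close> would be closed under
    adjacency and, by connectedness, be all vertices. A vector \<open>t\<close> off that line gives
    another one.\<close>
  have "\<exists>u w. cross2 u w \<noteq> 0 \<and> (\<nu> u, \<nu> w) \<in> parcs X"
  proof (rule ccontr)
    assume "\<not> ?thesis"
    then have no: "(\<nu> u, \<nu> w) \<notin> parcs X" if "cross2 u w \<noteq> 0" for u w using that by blast
    let ?S = "{\<nu> (a *s w0) | a. a \<noteq> 0}"
    have "pverts X \<subseteq> ?S"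
    proof (rule connected_pair_graph_closed_set [OF X _ v])
      have "v = \<nu> (1 *s w0)" using \<nu> [of "mat 1"] one_v by simp
      then show "v \<in> ?S" using one_neq_zero by blast
    next
      fix x y assume "x \<in> ?S" "(x, y) \<in> parcs X"
      then obtain a where a: "a \<noteq> 0" "(\<nu> (a *s w0), y) \<in> parcs X" by blast
      then obtain w where w: "w \<noteq> 0" "\<nu> w = y" using \<nu>_surj in_arcsD2 by metis
      then have "cross2 (a *s w0) w = 0" using no a by blast
      then have "cross2 w0 w = 0" using a by simp
      then obtain b where "w = b *s w0" using cross2_eq_0D w0 by blast
      then show "y \<in> ?S" using w by auto
    qed
    moreover obtain t where t: "cross2 w0 t = 1" using ex_cross2_eq_1 [OF w0] .
    moreover from t have "t \<noteq> 0" by auto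
    ultimately obtain a where a: "\<nu> t = \<nu> (a *s w0)" "a \<noteq> 0" using \<nu>_in [of t] by blast
    then obtain b where "t = b *s (a *s w0)"
      using \<nu>_eq [of "a *s w0" t] w0 \<open>t \<noteq> 0\<close> by auto
    then show False using t by simp
  qed
  then obtain u1 w1 where uw: "cross2 u1 w1 \<noteq> 0" "(\<nu> u1, \<nu> w1) \<in> parcs X" by blast
  obtain y L where L: "L \<ge> 3" and y: "\<And>i. y i \<noteq> 0" "\<And>i. cross2 (y i) (y (Suc i)) = cross2 u1 w1"
    and y_closed: "\<exists>a. a ^ n = 1 \<and> y L = a *s y 0"
    and y_inj: "\<And>i j a. i < L \<Longrightarrow> j < L \<Longrightarrow> a ^ n = 1 \<Longrightarrow> y j = a *s y i \<Longrightarrow> i = j"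
    and y_surj: "\<And>w. w \<noteq> 0 \<Longrightarrow> \<exists>i<L. \<exists>a. a ^ n = 1 \<and> w = a *s y i"
    by (rule ex_hamiltonian_lift [OF q uw(1)]) (rule that; assumption)
  have "hamilton_cycle X (map (\<lambda>i. (\<nu> (y i), \<nu> (y (Suc i)))) [0..<L])"
  proof (rule hamilton_cycle_map_upt [OF L])
    show "(\<lambda>i. \<nu> (y i)) ` {..<L} = pverts X"
    proof
      show "(\<lambda>i. \<nu> (y i)) ` {..<L} \<subseteq> pverts X" using \<nu>_in y(1) by blast
      show "pverts X \<subseteq> (\<lambda>i. \<nu> (y i)) ` {..<L}"
      proof
        fix x assume "x \<in> pverts X"
        then obtain w where w: "w \<noteq> 0" "\<nu> w = x" using \<nu>_surj by blast
        then obtain i where "i < L" "\<nu> (y i) = \<nu> w" using y_surj [OF w(1)] \<nu>_eq y(1) by metis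
        then show "x \<in> (\<lambda>i. \<nu> (y i)) ` {..<L}" using w by force
      qed
    qed
    show "inj_on (\<lambda>i. \<nu> (y i)) {..<L}"
      using y_inj \<nu>_eq y(1) by (intro inj_onI) (metis lessThan_iff)
    show "(\<nu> (y i), \<nu> (y (Suc i))) \<in> parcs X" for i
      using \<nu>_arcs [of "y i" "y (Suc i)" u1 w1] y(2) uw by simp
    show "\<nu> (y L) = \<nu> (y 0)" using y_closed \<nu>_eq y(1) by metis
  qed
  then show ?thesis by blast
qed

section \<open>From PSL(2) to SL(2)\<close>

lemma comm_group_elementary_abelian_group: "comm_group (elementary_abelian_group s m)"
proof -
  interpret group "elementary_abelian_group s m" by (simp add: elementary_abelian_group_def)
  show ?thesis
    by (rule group_comm_groupI) (auto simp: elementary_abelian_group_def add.commute)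
qed

lemma card_elementary_abelian_group:
  assumes "s > 0"
  shows "card (carrier (elementary_abelian_group s m)) = s ^ m"
  using assms by (simp add: elementary_abelian_group_def card_PiE carrier_integer_mod_group)

lemma elementary_abelian_group_pow:
  assumes x: "x \<in> carrier (elementary_abelian_group s m)"
  shows "x [^]\<^bsub>elementary_abelian_group s m\<^esub> s = \<one>\<^bsub>elementary_abelian_group s m\<^esub>"
proof -
  have "x [^]\<^bsub>elementary_abelian_group s m\<^esub> k = (\<lambda>i\<in>{..<m}. x i [^]\<^bsub>integer_mod_group s\<^esub> k)" for k :: nat
    by (induction k) (auto simp: elementary_abelian_group_def nat_pow_def algebra_simps mod_simps)
  then show ?thesis by (auto simp: elementary_abelian_group_def)
qed

text \<open>\<open>N\<close> embeds as the pairs with second entry 1. As it is abelian, conjugation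
  by \<open>(a, h)\<close> acts on it as \<open>\<phi> h\<close> alone, which gives
  \<open>y\<close>. Normality is stated without inverses, as needed for lifting to matrices.\<close>

lemma semidirect_prod_normal_factor:
  assumes K: "group K" "K \<cong> semidirect_prod N C \<phi>"
    and N: "comm_group N" and C: "group C" and \<phi>: "\<phi> \<in> hom C (AutoGroup N)"
  obtains f where "f \<in> hom N K" "inj_on f (carrier N)"
    "\<And>g x. g \<in> carrier K \<Longrightarrow> x \<in> carrier N \<Longrightarrow> \<exists>y\<in>carrier N. g \<otimes>\<^bsub>K\<^esub> f x = f y \<otimes>\<^bsub>K\<^esub> g"
    "card (carrier K) = card (carrier N) * card (carrier C)"
proof -
  interpret N: comm_group N by fact
  interpret C: group C by fact
  let ?S = "semidirect_prod N C \<phi>"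
  obtain \<theta>' where "\<theta>' \<in> iso K ?S" using K(2) by (auto simp: is_iso_def)
  then obtain \<theta> where \<theta>: "\<theta> \<in> iso ?S K" using group.iso_set_sym [OF K(1)] by blast
  have bij: "bij_betw \<theta> (carrier N \<times> carrier C) (carrier K)"
    using \<theta> by (simp add: iso_def semidirect_prod_def)
  have \<theta>_mult: "\<theta> (a, h) \<otimes>\<^bsub>K\<^esub> \<theta> (b, k) = \<theta> (a \<otimes>\<^bsub>N\<^esub> \<phi> h b, h \<otimes>\<^bsub>C\<^esub> k)"
    if "a \<in> carrier N" "h \<in> carrier C" "b \<in> carrier N" "k \<in> carrier C" for a h b k
    using that hom_mult [of \<theta> ?S K "(a, h)" "(b, k)"] \<theta> by (auto simp: iso_def semidirect_prod_def)
  have "\<phi> \<one>\<^bsub>C\<^esub> = \<one>\<^bsub>AutoGroup N\<^esub>"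
    using hom_one [OF \<phi> C N.AutoGroup] .
  then have \<phi>_one: "\<phi> \<one>\<^bsub>C\<^esub> x = x" if "x \<in> carrier N" for x
    using that by (simp add: AutoGroup_def BijGroup_def)
  have \<phi>_closed: "\<phi> h x \<in> carrier N" if "h \<in> carrier C" "x \<in> carrier N" for h x
    using hom_in_carrier [OF \<phi> that(1)] that(2) by (auto simp: AutoGroup_def auto_def hom_def)
  let ?f = "\<lambda>x. \<theta> (x, \<one>\<^bsub>C\<^esub>)"
  show ?thesis
  proof (rule that)
    show "?f \<in> hom N K"
      using bij by (auto simp: hom_def \<theta>_mult \<phi>_one dest: bij_betwE)
    show "inj_on ?f (carrier N)"
      using bij C.one_closed by (fastforce simp: bij_betw_def inj_on_def)
    show "card (carrier K) = card (carrier N) * card (carrier C)"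
      using bij_betw_same_card [OF bij] by (simp add: card_cartesian_product)
  next
    fix g x assume "g \<in> carrier K" and x: "x \<in> carrier N"
    then obtain a h where g: "g = \<theta> (a, h)" and ah: "a \<in> carrier N" "h \<in> carrier C"
      using bij_betw_imp_surj_on [OF bij] by blast
    have "g \<otimes>\<^bsub>K\<^esub> ?f x = ?f (\<phi> h x) \<otimes>\<^bsub>K\<^esub> g"
      using ah x by (simp add: g \<theta>_mult \<phi>_one \<phi>_closed N.m_comm)
    then show "\<exists>y\<in>carrier N. g \<otimes>\<^bsub>K\<^esub> ?f x = ?f y \<otimes>\<^bsub>K\<^esub> g" using \<phi>_closed ah x by blast
  qed
qed

text \<open>The quotient map by the center, followed by the isomorphism; its fibres are the cosets
  of the two signs.\<close>

lemma SL2_double_cover: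
  assumes K: "group K" "K \<cong> (PSL :: ('f::field ^ 2 ^ 2) set monoid)"
  obtains \<Phi> :: "'f::field ^ 2 ^ 2 \<Rightarrow> _" where "\<Phi> \<in> hom SL K" "\<Phi> ` carrier SL = carrier K"
    "\<And>A B. det A = 1 \<Longrightarrow> det B = 1 \<Longrightarrow> \<Phi> A = \<Phi> B \<longleftrightarrow> A = B \<or> A = mat (- 1) ** B"
proof -
  interpret SL: group "SL :: ('f ^ 2 ^ 2) monoid" by (rule group_SL)
  interpret Z: normal "center SL" "SL :: ('f ^ 2 ^ 2) monoid" by (rule SL.normal_center)
  obtain \<psi>' where "\<psi>' \<in> iso K (PSL :: ('f ^ 2 ^ 2) set monoid)" using K(2) by (auto simp: is_iso_def)
  then obtain \<psi> where \<psi>: "\<psi> \<in> iso (PSL :: ('f ^ 2 ^ 2) set monoid) K"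
    using group.iso_set_sym [OF K(1)] by blast
  define \<pi> :: "'f ^ 2 ^ 2 \<Rightarrow> _" where "\<pi> A = center SL #>\<^bsub>SL\<^esub> A" for A
  have \<pi>: "\<pi> \<in> hom SL PSL" unfolding PSL_def \<pi>_def [abs_def] by (rule Z.r_coset_hom_Mod)
  have \<pi>_img: "\<pi> ` carrier SL = carrier PSL"
    by (auto simp: PSL_def FactGroup_def RCOSETS_def \<pi>_def)
  have \<pi>_set: "\<pi> A = {A, mat (- 1) ** A}" for A
    by (auto simp: \<pi>_def r_coset_def center_SL2) (auto simp: SL_def)
  have neg: "mat (- 1) ** (mat (- 1) ** A) = A" for A :: "'f ^ 2 ^ 2"
    by (simp add: matrix_eq matrix_vector_mul_assoc [symmetric] mat_mult_vec)
  have \<pi>_eq: "\<pi> A = \<pi> B \<longleftrightarrow> A = B \<or> A = mat (- 1) ** B" for A B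
    unfolding \<pi>_set using neg by (metis doubleton_eq_iff)
  show ?thesis
  proof (rule that [of "\<lambda>A. \<psi> (\<pi> A)"])
    show "(\<lambda>A. \<psi> (\<pi> A)) \<in> hom SL K"
      using hom_compose [OF \<pi>, of \<psi> K] \<psi> by (simp add: iso_def comp_def)
    show "(\<lambda>A. \<psi> (\<pi> A)) ` carrier SL = carrier K"
      using \<psi> by (simp add: image_image [symmetric, of \<psi> \<pi>] \<pi>_img iso_def bij_betw_def)
    fix A B :: "'f ^ 2 ^ 2" assume "det A = 1" "det B = 1"
    then have "\<pi> A \<in> carrier PSL" "\<pi> B \<in> carrier PSL"
      unfolding \<pi>_img [symmetric] by (auto simp: SL_def)
    then show "\<psi> (\<pi> A) = \<psi> (\<pi> B) \<longleftrightarrow> A = B \<or> A = mat (- 1) ** B"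
      using \<psi> \<pi>_eq by (metis (no_types, lifting) bij_betw_def inj_on_eq_iff iso_def mem_Collect_eq)
  qed
qed

text \<open>Each fibre is a pair of opposite matrices, and these differ because 1 and -1 do.\<close>

lemma card_SL2_double_cover_vimage:
  fixes \<Phi> :: "'f::{field,finite} ^ 2 ^ 2 \<Rightarrow> 'k"
  assumes neg: "(1 :: 'f) \<noteq> - 1" and T: "T \<subseteq> \<Phi> ` carrier SL"
    and \<Phi>: "\<And>A B. det A = 1 \<Longrightarrow> det B = 1 \<Longrightarrow> \<Phi> A = \<Phi> B \<longleftrightarrow> A = B \<or> A = mat (- 1) ** B"
  shows "card {A. det A = 1 \<and> \<Phi> A \<in> T} = 2 * card T"
proof -
  have "finite T" using T finite_subset by fastforce
  have fib: "card {A. det A = 1 \<and> \<Phi> A = g} = 2" if g: "g \<in> T" for g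
  proof -
    obtain B where B: "det B = 1" "\<Phi> B = g" using T g by (auto simp: SL_def)
    have d: "det (mat (- 1) ** B) = 1" using B by (simp add: det_mul) (simp add: det_2 mat_def)
    have "{A. det A = 1 \<and> \<Phi> A = g} = {B, mat (- 1) ** B}"
    proof (rule Set.set_eqI)
      fix A show "A \<in> {A. det A = 1 \<and> \<Phi> A = g} \<longleftrightarrow> A \<in> {B, mat (- 1) ** B}"
        using \<Phi> [of A B] B d by auto
    qed
    moreover have "B \<noteq> mat (- 1) ** B"
    proof
      assume e: "B = mat (- 1) ** B"
      obtain C where C: "B ** C = mat 1" using SL2_inverse [OF B(1)] .
      have "mat 1 = (mat (- 1) :: 'f ^ 2 ^ 2)"
        using arg_cong [OF e, of "\<lambda>M. M ** C"] by (simp add: matrix_mul_assoc [symmetric] C)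
      then have "(mat 1 :: 'f ^ 2 ^ 2) $ 1 $ 1 = (mat (- 1) :: 'f ^ 2 ^ 2) $ 1 $ 1" by simp
      then show False using neg by (simp add: mat_def)
    qed
    ultimately show ?thesis by simp
  qed
  have "{A. det A = 1 \<and> \<Phi> A \<in> T} = (\<Union>g\<in>T. {A. det A = 1 \<and> \<Phi> A = g})" by auto
  also have "card \<dots> = (\<Sum>g\<in>T. card {A. det A = 1 \<and> \<Phi> A = g})"
    by (rule card_UN_disjoint) (use \<open>finite T\<close> in auto)
  also have "\<dots> = (\<Sum>g\<in>T. 2)" by (rule sum.cong) (use fib in auto)
  finally show ?thesis by simp
qed

text \<open>Turns exponents in the group \<open>SL\<close> into iterates on vectors, the form used
  for finding eigenvectors.\<close>

lemma SL_pow_mult_vec: "(A [^]\<^bsub>SL\<^esub> k) *v w = (((*v) A) ^^ k) (w :: 'f::field ^ 2)" for k :: nat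
proof (induction k arbitrary: w)
  case 0
  then show ?case by (simp add: SL_def nat_pow_def)
next
  case (Suc k)
  have "A [^]\<^bsub>SL\<^esub> Suc k = (A [^]\<^bsub>SL\<^esub> k) ** A" by (simp add: SL_def nat_pow_def)
  then show ?case
    using Suc [of "A *v w"]
    by (simp add: matrix_vector_mul_assoc [symmetric] funpow_swap1)
qed

lemma CHAR_eq_prime_if_CARD_eq_power:
  assumes "Factorial_Ring.prime s" "CARD('f::{field,finite}) = s ^ m"
  shows "CHAR('f) = s"
proof -
  have "Factorial_Ring.prime CHAR('f)"
    by (rule prime_CHAR_semidom) (simp add: finite_imp_CHAR_pos)
  moreover have "CHAR('f) dvd s ^ m" using CHAR_dvd_CARD [where 'a = 'f] assms by simp
  ultimately show ?thesis
    using assms(1) by (metis prime_dvd_power primes_dvd_imp_eq)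
qed

section \<open>The vertex stabilizer as the stabilizer of a line, and the conclusion\<close>

theorem theorem1p1:
  fixes s m p :: nat
    and X :: "'v pair_pre_digraph"
    and G :: "('v \<Rightarrow> 'v) set"
    and v :: 'v
  assumes "Factorial_Ring.prime s" and "m \<ge> 1"
    and "Factorial_Ring.prime p" and "s ^ m + 1 = 2 * p" and "10 dvd s ^ m - 1"
    and "CARD('f::{field,finite}) = s ^ m"
    and "pair_graph X" and "Digraph_Component.connected (with_proj X)"
    and "subgroup G (graph_Aut X)"
    and "(graph_Aut X)\<lparr>carrier := G\<rparr> \<cong> (PSL :: ('f ^ 2 ^ 2) set monoid)"
    and "transitive_action ((graph_Aut X)\<lparr>carrier := G\<rparr>) (pverts X) (\<lambda>g. g)"
    and "v \<in> pverts X"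
    and "\<exists>\<phi> \<in> hom (integer_mod_group ((s ^ m - 1) div 10))
                   (AutoGroup (elementary_abelian_group s m)).
           (graph_Aut X)\<lparr>carrier := stabilizer ((graph_Aut X)\<lparr>carrier := G\<rparr>) (\<lambda>g. g) v\<rparr>
           \<cong> semidirect_prod (elementary_abelian_group s m)
               (integer_mod_group ((s ^ m - 1) div 10)) \<phi>"
  shows "\<exists>c. hamilton_cycle X c"
proof -
  let ?E = "elementary_abelian_group s m" and ?K = "(graph_Aut X)\<lparr>carrier := G\<rparr>"
  define k where "k = (s ^ m - 1) div 10"
  \<comment> \<open>The cyclic factor has order \<open>k\<close>; the preimage of the stabilizer in
    SL(2) is twice as large as the stabilizer, which doubles the number of eigenvalues.\<close>
  define n where "n = 2 * k"
  have s: "s > 1" using assms(1) prime_gt_1_nat by blast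
  have q1: "s ^ m > 1" using s assms(2) one_less_power [of s m] by simp
  then have q10: "CARD('f) = 10 * k + 1" using assms(5,6) by (simp add: k_def)
  then have q: "CARD('f) = 5 * n + 1" "odd CARD('f)" "n > 0" using q1 assms(6) by (auto simp: n_def)
  have char: "CHAR('f) = s" using CHAR_eq_prime_if_CARD_eq_power assms(1,6) by blast
  have odd_s: "odd s" using q(2) assms(2,6) by simp
  have neg: "(1 :: 'f) \<noteq> - 1"
  proof
    assume "(1 :: 'f) = - 1"
    then have "of_nat 2 = (0 :: 'f)" by (simp add: eq_neg_iff_add_eq_0)
    then have "s dvd 2" using char of_nat_eq_0_iff_char_dvd by metis
    then show False using odd_s s dvd_imp_le [of s 2] by (cases "s = 2") auto
  qed

  interpret K: group ?K using subgroup.subgroup_is_group [OF assms(9) group_graph_Aut] .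
  interpret act: transitive_action ?K "pverts X" "\<lambda>g. g" by fact
  let ?S = "stabilizer ?K (\<lambda>g. g) v"
  let ?KS = "(graph_Aut X)\<lparr>carrier := ?S\<rparr>"
  have S_sub: "subgroup ?S ?K" using act.stabilizer_subgroup assms(12) .
  interpret KS: group ?KS
    using subgroup.subgroup_is_group [OF S_sub K.is_group] by simp
  have S_G: "?S \<subseteq> G" by (auto simp: stabilizer_def)
  interpret E: comm_group ?E by (rule comm_group_elementary_abelian_group)

  obtain \<Phi> :: "'f ^ 2 ^ 2 \<Rightarrow> 'v \<Rightarrow> 'v" where \<Phi>: "\<Phi> \<in> hom SL ?K" "\<Phi> ` carrier SL = carrier ?K"
    and \<Phi>_eq: "\<And>A B. det A = 1 \<Longrightarrow> det B = 1 \<Longrightarrow> \<Phi> A = \<Phi> B \<longleftrightarrow> A = B \<or> A = mat (- 1) ** B"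
    by (rule SL2_double_cover [OF K.is_group assms(10)]) (rule that; assumption)
  interpret SL: group "SL :: ('f ^ 2 ^ 2) monoid" by (rule group_SL)
  interpret \<Phi>: group_hom SL ?K \<Phi> by unfold_locales (rule \<Phi>(1))
  have \<Phi>_G: "\<Phi> A \<in> G" if "det A = 1" for A using \<Phi>.hom_closed [of A] that by (simp add: SL_def)
  have \<Phi>_mult: "\<Phi> (A ** B) = \<Phi> A \<otimes>\<^bsub>graph_Aut X\<^esub> \<Phi> B" if "det A = 1" "det B = 1" for A B
    using \<Phi>.hom_mult [of A B] that by (simp add: SL_def)
  have \<Phi>_surj: "\<exists>A. det A = 1 \<and> \<Phi> A = g" if "g \<in> G" for g
    using \<Phi>(2) that by (auto simp: SL_def image_iff)
  \<comment> \<open>Relations in the image lift to relations up to sign.\<close>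
  have \<Phi>_eqD: "\<exists>\<epsilon>. \<epsilon> * \<epsilon> = 1 \<and> A = mat \<epsilon> ** B" if "det A = 1" "det B = 1" "\<Phi> A = \<Phi> B" for A B
    using \<Phi>_eq [OF that(1,2)] that(3) by (metis matrix_mul_lid mult_1 mult_minus1 minus_minus)

  obtain \<phi> where \<phi>: "\<phi> \<in> hom (integer_mod_group k) (AutoGroup ?E)"
    and iso: "?KS \<cong> semidirect_prod ?E (integer_mod_group k) \<phi>"
    using assms(13) unfolding k_def by blast
  obtain f where f_KS: "f \<in> hom ?E ?KS" and f_inj: "inj_on f (carrier ?E)"
    and f_normal: "\<And>g x. g \<in> carrier ?KS \<Longrightarrow> x \<in> carrier ?E \<Longrightarrow>
      \<exists>y\<in>carrier ?E. g \<otimes>\<^bsub>?KS\<^esub> f x = f y \<otimes>\<^bsub>?KS\<^esub> g"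
    and card_KS: "card (carrier ?KS) = card (carrier ?E) * card (carrier (integer_mod_group k))"
    by (rule semidirect_prod_normal_factor [OF KS.is_group iso E.comm_group_axioms
          group_integer_mod_group \<phi>])
      (rule that; assumption)
  have card_E: "card (carrier ?E) = CARD('f)" using card_elementary_abelian_group s assms(6) by simp
  have card_S: "card ?S = CARD('f) * k"
    using card_KS card_E q(3) by (simp add: carrier_integer_mod_group n_def)
  have f_S: "f x \<in> ?S" if "x \<in> carrier ?E" for x using hom_in_carrier [OF f_KS that] by simp
  have f_mult: "f (x \<otimes>\<^bsub>?E\<^esub> y) = f x \<otimes>\<^bsub>graph_Aut X\<^esub> f y" if "x \<in> carrier ?E" "y \<in> carrier ?E" for x y
    using hom_mult [OF f_KS that] by simp
  interpret f: group_hom ?E ?K f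
    by unfold_locales (use f_S S_G f_mult in \<open>auto simp: hom_def\<close>)

  \<comment> \<open>The preimages in SL(2) of the stabilizer and of its elementary abelian
    part.\<close>
  define H where "H = {A :: 'f ^ 2 ^ 2. det A = 1 \<and> \<Phi> A \<in> ?S}"
  define N where "N = {A :: 'f ^ 2 ^ 2. det A = 1 \<and> \<Phi> A \<in> f ` carrier ?E}"
  obtain w0 :: "'f ^ 2" where w0: "w0 \<noteq> 0"
    and H_iff: "\<And>A. det A = 1 \<Longrightarrow> A \<in> H \<longleftrightarrow> (\<exists>a. a ^ n = 1 \<and> A *v w0 = a *s w0)"
  proof (rule SL2_subgroup_is_eigenline_stabilizer [OF assms(1) char odd_s q(3), of H N])
    show "det A = 1" if "A \<in> H" for A using that by (simp add: H_def)
    show "A ** B \<in> H" if "A \<in> H" "B \<in> H" for A B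
      using that subgroup.m_closed [OF S_sub] by (auto simp: H_def det_mul \<Phi>_mult)
    show "N \<subseteq> H" using f_S by (auto simp: H_def N_def)
    show "card N = 2 * CARD('f)"
      unfolding N_def card_E [symmetric] card_image [OF f_inj, symmetric]
      by (rule card_SL2_double_cover_vimage [OF neg _ \<Phi>_eq]) (use f_S S_G \<Phi>(2) in auto)
    have "card H = 2 * card ?S"
      unfolding H_def by (rule card_SL2_double_cover_vimage [OF neg _ \<Phi>_eq]) (use S_G \<Phi>(2) in auto)
    then show "card H = CARD('f) * n" by (simp add: card_S n_def)
  next
    fix A assume "A \<in> N"
    then obtain x where A: "det A = 1" and x: "x \<in> carrier ?E" "\<Phi> A = f x" by (auto simp: N_def)
    have A_SL: "A \<in> carrier SL" using A by (simp add: SL_def)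
    \<comment> \<open>The elementary abelian group has exponent dividing \<open>s\<close>, so the
      \<open>s\<close>-th power of \<open>A\<close> is a sign.\<close>
    have "\<Phi> (A [^]\<^bsub>SL\<^esub> s) = f (x [^]\<^bsub>?E\<^esub> s)"
      using \<Phi>.hom_nat_pow [OF A_SL, of s] f.hom_nat_pow [OF x(1), of s] x(2) by simp
    also have "\<dots> = \<Phi> (mat 1)"
      using elementary_abelian_group_pow [OF x(1)] f.hom_one \<Phi>.hom_one by (simp add: SL_def)
    finally have "\<Phi> (A [^]\<^bsub>SL\<^esub> s) = \<Phi> (mat 1)" .
    moreover have "det (A [^]\<^bsub>SL\<^esub> s) = 1" using SL.nat_pow_closed [OF A_SL, of s] by (simp add: SL_def)
    ultimately obtain \<epsilon> where "\<epsilon> * \<epsilon> = 1" "A [^]\<^bsub>SL\<^esub> s = mat \<epsilon> ** mat 1"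
      using \<Phi>_eqD [of "A [^]\<^bsub>SL\<^esub> s" "mat 1"] by auto
    then show "\<exists>\<epsilon>. \<epsilon> * \<epsilon> = 1 \<and> (\<forall>w. (((*v) A) ^^ s) w = \<epsilon> *s w)"
      by (auto simp: SL_pow_mult_vec [symmetric] mat_mult_vec)
  next
    fix A B assume "A \<in> N" "B \<in> N"
    then obtain x y where A: "det A = 1" "x \<in> carrier ?E" "\<Phi> A = f x"
      and B: "det B = 1" "y \<in> carrier ?E" "\<Phi> B = f y" by (auto simp: N_def)
    have "\<Phi> (A ** B) = \<Phi> (B ** A)"
      using A B E.m_comm [of x y] f_mult [of x y] f_mult [of y x] by (simp add: \<Phi>_mult)
    then show "\<exists>\<epsilon>. \<epsilon> * \<epsilon> = 1 \<and> A ** B = mat \<epsilon> ** (B ** A)"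
      using A B by (intro \<Phi>_eqD) (simp_all add: det_mul)
  next
    fix A B assume "A \<in> H" "B \<in> N"
    then obtain x where A: "det A = 1" "\<Phi> A \<in> ?S"
      and B: "det B = 1" "x \<in> carrier ?E" "\<Phi> B = f x" by (auto simp: H_def N_def)
    obtain y where y: "y \<in> carrier ?E" "\<Phi> A \<otimes>\<^bsub>graph_Aut X\<^esub> f x = f y \<otimes>\<^bsub>graph_Aut X\<^esub> \<Phi> A"
      using f_normal [of "\<Phi> A" x] A B by auto
    obtain B' where B': "det B' = 1" "\<Phi> B' = f y" using \<Phi>_surj f_S S_G y(1) by blast
    have "\<Phi> (A ** B) = \<Phi> (B' ** A)" using A B B' y by (simp add: \<Phi>_mult)
    \<comment> \<open>The sign is absorbed into \<open>B'\<close>, whose negative has the same image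
      and so also lies in \<open>N\<close>.\<close>
    then consider "A ** B = B' ** A" | "A ** B = (mat (- 1) ** B') ** A"
      using \<Phi>_eq [of "A ** B" "B' ** A"] A B B' by (auto simp: det_mul matrix_mul_assoc)
    moreover have "det (mat (- 1) ** B') = 1" using B' by (simp add: det_mul) (simp add: det_2 mat_def)
    moreover from this have "\<Phi> (mat (- 1) ** B') = f y"
      using \<Phi>_eq [of "mat (- 1) ** B'" B'] B' by simp
    ultimately show "\<exists>B'\<in>N. A ** B = B' ** A"
      using B' y(1) unfolding N_def by cases blast+
  qed (rule that; assumption)
  have in_Bij: "g \<in> Bij (pverts X)" if "g \<in> G" for g
    using that subgroup.subset [OF assms(9)] by (auto simp: graph_Aut_def)
  show ?thesis
  proof (rule hamiltonian_if_SL2_acts [OF assms(7,8,12) q _ _ _ _ w0, of \<Phi>])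
    fix A :: "'f ^ 2 ^ 2" assume A: "det A = 1"
    show "\<Phi> A x \<in> pverts X" if "x \<in> pverts X" for x
      using in_Bij [OF \<Phi>_G [OF A]] that by (auto simp: Bij_def bij_betw_def)
    show "\<Phi> (A ** B) x = \<Phi> A (\<Phi> B x)" if "det B = 1" "x \<in> pverts X" for B x
      using A that in_Bij \<Phi>_G by (simp add: \<Phi>_mult graph_Aut_def BijGroup_def compose_def)
    show "(\<Phi> A x, \<Phi> A y) \<in> parcs X \<longleftrightarrow> (x, y) \<in> parcs X" if "x \<in> pverts X" "y \<in> pverts X" for x y
      using \<Phi>_G [OF A] subgroup.subset [OF assms(9)] that by (auto simp: graph_Aut_def)
    show "\<Phi> A v = v \<longleftrightarrow> (\<exists>a. a ^ n = 1 \<and> A *v w0 = a *s w0)"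
      using H_iff [OF A] A \<Phi>_G [OF A] by (auto simp: H_def stabilizer_def)
  next
    fix x assume "x \<in> pverts X"
    then obtain g where "g \<in> G" "g v = x" using act.unique_orbit [OF assms(12)] by auto
    then show "\<exists>A. det A = 1 \<and> \<Phi> A v = x" using \<Phi>_surj by blast
  qed
qed

end
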